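(* Let $(G,t,k)$ be an input with $G=(V,E)$, $n=|V|$, $m=|E|$, and let $\ell:=n-k$. Then $t$-Hereditary 2-Club and $t$-Robust 2-Club can be solved in $O(2^{\ell}\cdot nm)$ time, and $t$-Connected 2-Club can be solved in $O(2^{\ell}\cdot t^2 nm)$ time.
   Context: All graphs are simple and undirected. For a graph $G=(V,E)$ and $S\subseteq V$, $G[S]$ is the induced subgraph; $S$ is a 2-club if $G[S]$ has diameter at most two. $S$ is a $t$-robust 2-club if every pair of vertices of $S$ is connected in $G[S]$ by $t$ internally vertex-disjoint paths of length at most two. $S$ is a $t$-hereditary 2-club if $G[S\setminus U]$ is a 2-club for every $U\subset S$ with $|U|\le t$. $S$ is a $t$-connected 2-club if it is a 2-club, $|S|>t$, and $G[S\setminus U]$ is connected for all $U\subseteq S$ with $|U|<t$. The problems $t$-Robust / $t$-Hereditary / $t$-Connected 2-Club take as input an undirected graph $G$ and nonnegative integers $t$ and $k$ and ask whether $G$ contains a $t$-robust / $t$-hereditary / $t$-connected 2-club of size at least $k$. *)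

theory Defs
  imports "HOL-Library.Extended_Nat" "HOL-Library.Disjoint_Sets"
begin

section \<open>Simple undirected graphs\<close>

type_synonym 'a graph = "'a set \<times> 'a set set"

abbreviation verts :: "'a graph \<Rightarrow> 'a set" where "verts \<equiv> fst"
abbreviation edges :: "'a graph \<Rightarrow> 'a set set" where "edges \<equiv> snd"

definition simple_graph :: "'a graph \<Rightarrow> bool" where
  "simple_graph G \<longleftrightarrow> finite (verts G) \<and> (\<forall>e\<in>edges G. e \<subseteq> verts G \<and> card e = 2)"

definition induced :: "'a graph \<Rightarrow> 'a set \<Rightarrow> 'a graph" where
  "induced G S = (verts G \<inter> S, {e \<in> edges G. e \<subseteq> S})"

definition is_path :: "'a graph \<Rightarrow> 'a \<Rightarrow> 'a list \<Rightarrow> 'a \<Rightarrow> bool" where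
  "is_path G u p v \<longleftrightarrow> p \<noteq> [] \<and> hd p = u \<and> last p = v \<and> distinct p \<and> set p \<subseteq> verts G \<and>
     successively (\<lambda>x y. {x, y} \<in> edges G) p"

definition path_length :: "'a list \<Rightarrow> nat" where
  "path_length p = length p - 1"

definition internal_verts :: "'a list \<Rightarrow> 'a set" where
  "internal_verts p = set (butlast (tl p))"

text \<open>The distance is \<open>\<infinity>\<close> if there is no path, and the diameter of the empty graph is \<open>0\<close>.\<close>

definition distance :: "'a graph \<Rightarrow> 'a \<Rightarrow> 'a \<Rightarrow> enat" where
  "distance G u v = (INF p\<in>{p. is_path G u p v}. enat (path_length p))"

definition graph_diameter :: "'a graph \<Rightarrow> enat" where
  "graph_diameter G = (SUP u\<in>verts G. SUP v\<in>verts G. distance G u v)"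

definition graph_connected :: "'a graph \<Rightarrow> bool" where
  "graph_connected G \<longleftrightarrow> (\<forall>u\<in>verts G. \<forall>v\<in>verts G. \<exists>p. is_path G u p v)"


section \<open>Robust, hereditary and connected 2-clubs\<close>

definition two_club :: "'a graph \<Rightarrow> 'a set \<Rightarrow> bool" where
  "two_club G S \<longleftrightarrow> graph_diameter (induced G S) \<le> 2"

text \<open>
  The edge joining two adjacent vertices is a path without internal vertices; it counts once,
  because the paths form a set.
\<close>

definition robust_two_club :: "nat \<Rightarrow> 'a graph \<Rightarrow> 'a set \<Rightarrow> bool" where
  "robust_two_club t G S \<longleftrightarrow>
     (\<forall>u\<in>S. \<forall>v\<in>S. u \<noteq> v \<longrightarrow>
        (\<exists>P. finite P \<and> card P = t \<and>
             (\<forall>p\<in>P. is_path (induced G S) u p v \<and> path_length p \<le> 2) \<and>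
             disjoint_family_on internal_verts P))"

definition hereditary_two_club :: "nat \<Rightarrow> 'a graph \<Rightarrow> 'a set \<Rightarrow> bool" where
  "hereditary_two_club t G S \<longleftrightarrow> (\<forall>U. U \<subset> S \<and> card U \<le> t \<longrightarrow> two_club G (S - U))"

definition connected_two_club :: "nat \<Rightarrow> 'a graph \<Rightarrow> 'a set \<Rightarrow> bool" where
  "connected_two_club t G S \<longleftrightarrow>
     two_club G S \<and> card S > t \<and>
     (\<forall>U. U \<subseteq> S \<and> card U < t \<longrightarrow> graph_connected (induced G (S - U)))"


section \<open>Random access machine programs\<close>

text \<open>
  Time is measured on a uniform-cost random access machine: finitely many registers are named by
  the program, and there is one unbounded memory with indirect addressing. Cells hold natural
  numbers. Every operator, register or memory access, constant and test costs one step. There is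
  deliberately no multiplication, so that numbers gain only a constant number of bits per step.
  Subtraction is truncated.
\<close>

datatype aexp = Const nat | Reg nat | Mem aexp | Add aexp aexp | Sub aexp aexp

datatype bexp = Less aexp aexp | Equal aexp aexp | Neg bexp | Conj bexp bexp

datatype com =
    Skip
  | Assign nat aexp
  | Store aexp aexp
  | Seq com com
  | Cond bexp com com
  | While bexp com

type_synonym state = "(nat \<Rightarrow> nat) \<times> (nat \<Rightarrow> nat)"

fun aval :: "aexp \<Rightarrow> state \<Rightarrow> nat" where
  "aval (Const c) s = c"
| "aval (Reg r) s = fst s r"
| "aval (Mem a) s = snd s (aval a s)"
| "aval (Add a b) s = aval a s + aval b s"
| "aval (Sub a b) s = aval a s - aval b s"

fun acost :: "aexp \<Rightarrow> nat" where
  "acost (Const c) = 1"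
| "acost (Reg r) = 1"
| "acost (Mem a) = 1 + acost a"
| "acost (Add a b) = 1 + acost a + acost b"
| "acost (Sub a b) = 1 + acost a + acost b"

fun bval :: "bexp \<Rightarrow> state \<Rightarrow> bool" where
  "bval (Less a b) s \<longleftrightarrow> aval a s < aval b s"
| "bval (Equal a b) s \<longleftrightarrow> aval a s = aval b s"
| "bval (Neg b) s \<longleftrightarrow> \<not> bval b s"
| "bval (Conj b c) s \<longleftrightarrow> bval b s \<and> bval c s"

fun bcost :: "bexp \<Rightarrow> nat" where
  "bcost (Less a b) = 1 + acost a + acost b"
| "bcost (Equal a b) = 1 + acost a + acost b"
| "bcost (Neg b) = 1 + bcost b"
| "bcost (Conj b c) = 1 + bcost b + bcost c"

text \<open>
  \<open>exec c s T s'\<close>: started in state \<open>s\<close>, the program \<open>c\<close> halts after exactly \<open>T\<close> steps in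
  state \<open>s'\<close>.
\<close>

inductive exec :: "com \<Rightarrow> state \<Rightarrow> nat \<Rightarrow> state \<Rightarrow> bool" where
  Skip: "exec Skip s 1 s"
| Assign: "exec (Assign r a) s (1 + acost a) ((fst s)(r := aval a s), snd s)"
| Store: "exec (Store a b) s (1 + acost a + acost b) (fst s, (snd s)(aval a s := aval b s))"
| Seq: "exec c1 s T1 s' \<Longrightarrow> exec c2 s' T2 s'' \<Longrightarrow> exec (Seq c1 c2) s (T1 + T2) s''"
| CondTrue: "bval b s \<Longrightarrow> exec c1 s T s' \<Longrightarrow> exec (Cond b c1 c2) s (1 + bcost b + T) s'"
| CondFalse: "\<not> bval b s \<Longrightarrow> exec c2 s T s' \<Longrightarrow> exec (Cond b c1 c2) s (1 + bcost b + T) s'"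
| WhileFalse: "\<not> bval b s \<Longrightarrow> exec (While b c) s (1 + bcost b) s"
| WhileTrue: "bval b s \<Longrightarrow> exec c s T1 s' \<Longrightarrow> exec (While b c) s' T2 s'' \<Longrightarrow>
    exec (While b c) s (1 + bcost b + T1 + T2) s''"

inductive_cases exec_elims:
  "exec Skip s T s'" "exec (Assign r a) s T s'" "exec (Store a b) s T s'"
  "exec (Seq c1 c2) s T s'" "exec (Cond b c1 c2) s T s'" "exec (While b c) s T s'"

lemma exec_deterministic:
  "exec c s T s' \<Longrightarrow> exec c s T' s'' \<Longrightarrow> T' = T \<and> s'' = s'"
proof (induction arbitrary: T' s'' rule: exec.induct)
  case Skip
  then show ?case by (auto elim: exec_elims(1))
next
  case Assign
  then show ?case by (auto elim: exec_elims(2))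
next
  case Store
  then show ?case by (auto elim: exec_elims(3))
next
  case (Seq c1 s T1 s1 c2 T2 s2)
  from Seq.prems obtain R1 R2 r1
    where "exec c1 s R1 r1" "exec c2 r1 R2 s''" "T' = R1 + R2"
    by (rule exec_elims(4)) simp
  with Seq.IH show ?case by metis
next
  case (CondTrue b s c1 T s' c2)
  from CondTrue.prems CondTrue.hyps(1) obtain R
    where "exec c1 s R s''" "T' = 1 + bcost b + R"
    by (auto elim: exec_elims(5))
  with CondTrue.IH show ?case by metis
next
  case (CondFalse b s c2 T s' c1)
  from CondFalse.prems CondFalse.hyps(1) obtain R
    where "exec c2 s R s''" "T' = 1 + bcost b + R"
    by (auto elim: exec_elims(5))
  with CondFalse.IH show ?case by metis
next
  case (WhileFalse b s c)
  from WhileFalse.prems WhileFalse.hyps show ?case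
    by (cases rule: exec.cases) auto
next
  case (WhileTrue b s c T1 s1 T2 s2)
  from WhileTrue.prems WhileTrue.hyps(1) obtain R1 R2 r1
    where "exec c s R1 r1" "exec (While b c) r1 R2 s''" "T' = 1 + bcost b + R1 + R2"
    by (cases rule: exec.cases) auto
  with WhileTrue.IH show ?case by metis
qed


section \<open>Problem instances and running time\<close>

text \<open>
  Inputs are graphs on the vertex set \<open>{..<n}\<close>, given by adjacency lists in arbitrary order.
  The memory initially contains, from address \<open>0\<close> on, the numbers \<open>n\<close>, \<open>t\<close>, \<open>k\<close>, then
  \<open>n + 1\<close> addresses, and then the concatenated adjacency lists: the neighbours of vertex \<open>u\<close> are
  stored from address \<open>mem (3 + u)\<close> up to, but excluding, address \<open>mem (4 + u)\<close>. All other cells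
  and all registers are \<open>0\<close>.
\<close>

definition adjacency_lists :: "nat graph \<Rightarrow> nat list list \<Rightarrow> bool" where
  "adjacency_lists G adj \<longleftrightarrow> verts G = {..<length adj} \<and>
     (\<forall>u<length adj. distinct (adj ! u) \<and> set (adj ! u) = {v. {u, v} \<in> edges G})"

definition encode :: "nat list list \<Rightarrow> nat \<Rightarrow> nat \<Rightarrow> nat list" where
  "encode adj t k =
     [length adj, t, k]
     @ map (\<lambda>u. length adj + 4 + length (concat (take u adj))) [0..<length adj + 1]
     @ concat adj"

definition initial_state :: "nat list \<Rightarrow> state" where
  "initial_state xs = ((\<lambda>_. 0), (\<lambda>i. if i < length xs then xs ! i else 0))"

text \<open>
  For a family \<open>Q\<close> of vertex set properties, the problem asks on input \<open>(G, t, k)\<close> whether \<open>G\<close>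
  contains a set with property \<open>Q t G\<close> of size at least \<open>k\<close>. A single program has to answer it for
  all inputs, in time \<open>O(f n m t k)\<close>; the answer is left in register \<open>0\<close>.
\<close>

definition solvable_in_time ::
    "(nat \<Rightarrow> nat graph \<Rightarrow> nat set \<Rightarrow> bool) \<Rightarrow> (nat \<Rightarrow> nat \<Rightarrow> nat \<Rightarrow> nat \<Rightarrow> nat) \<Rightarrow> bool" where
  "solvable_in_time Q f \<longleftrightarrow>
     (\<exists>prog C. \<forall>G adj t k. simple_graph G \<and> adjacency_lists G adj \<longrightarrow>
        (\<exists>T s. exec prog (initial_state (encode adj t k)) T s \<and>
           T \<le> C * f (card (verts G)) (card (edges G)) t k \<and>
           fst s 0 = (if \<exists>S\<subseteq>verts G. Q t G S \<and> card S \<ge> k then 1 else 0)))"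

text \<open>
  A product bound vanishes if one of \<open>n\<close>, \<open>m\<close>, \<open>t\<close> is \<open>0\<close>, although every program takes at
  least one step (and \<open>0\<close>-connected 2-clubs are just the nonempty 2-clubs). Such parameters are
  read as \<open>1\<close>; all others are unchanged.
\<close>

definition pos :: "nat \<Rightarrow> nat" where
  "pos x = max 1 x"

end

theory Submission imports Defs "HOL-Library.Multiset"
begin

text \<open>
  All three properties have the form ``every two vertices are joined by enough short paths, and few
  deletions keep the set connected''. If a pair \<open>u\<close>, \<open>v\<close> violates this in the current vertex set
  \<open>H\<close>, it does so in every subset of \<open>H\<close> that contains both, so one of the two must be deleted.
  Branching on that choice to depth \<open>n - k\<close> gives a search tree with less than \<open>2 * 2 ^ (n - k)\<close>
  nodes. The condition \<open>t < card S\<close> on connected 2-clubs is absorbed by raising \<open>k\<close> to \<open>t + 1\<close>.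

  At a node, common neighbours are counted for all pairs in time \<open>O(nm)\<close>. As soon as one vertex has
  no bad partner, \<open>H\<close> contains at most one isolated vertex and \<open>card H \<le> 2 * m + 1\<close>; otherwise the count stops
  at the first vertex. This is why no term \<open>n\<^sup>2\<close> appears.

  For connectivity, fix \<open>t\<close> vertices of \<open>H\<close>. A separator with less than \<open>t\<close> vertices misses one of
  them, say \<open>s\<close>, so \<open>t\<close> searches for augmenting paths from \<open>s\<close> to each other vertex suffice; this is
  \<open>t\<^sup>2 * n\<close> searches of cost \<open>O(m)\<close>.
\<close>

section \<open>Good vertex sets\<close>

text \<open>In general \<open>good\<close> is monotone neither upwards nor downwards; what a subset
  inherits is the badness of a pair. For connectivity this inheritance is the difficulty, since the
  definition speaks of deleted sets and not of pairs. A failed search therefore has to deliver a cut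
  of less than \<open>c\<close> vertices: its trace on any \<open>S\<close> that contains both ends
  is again a cut of \<open>S\<close>. Conversely, \<open>c\<close> disjoint paths must exclude such
  cuts. This is Menger's theorem in substance, but no system of paths is ever extracted: both
  directions follow by counting one multiset equation, \<open>linkage\<close>, on a set of vertices.

  The three problems are instances \<open>(\<alpha>, \<tau>, c)\<close> of \<open>good\<close>:
  \<open>(t + 1, t + 1, 0)\<close> for hereditary, \<open>(1, t, 0)\<close> for robust and
  \<open>(1, 1, t)\<close> for connected clubs.\<close>

definition common :: "'a set set \<Rightarrow> 'a set \<Rightarrow> 'a \<Rightarrow> 'a \<Rightarrow> 'a set" where
  "common E S u v = {w \<in> S. {u, w} \<in> E \<and> {w, v} \<in> E}"

text \<open>An edge is worth \<open>\<alpha>\<close> common neighbours: one path, or enough paths for any deletion.\<close>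

definition pair_ok :: "nat \<Rightarrow> nat \<Rightarrow> 'a set set \<Rightarrow> 'a set \<Rightarrow> 'a \<Rightarrow> 'a \<Rightarrow> bool" where
  "pair_ok \<alpha> \<tau> E S u v \<longleftrightarrow> \<tau> \<le> (if {u, v} \<in> E then \<alpha> else 0) + card (common E S u v)"

definition linked :: "'a set set \<Rightarrow> 'a set \<Rightarrow> ('a \<times> 'a) set" where
  "linked E S = {(u, v). u \<in> S \<and> v \<in> S \<and> {u, v} \<in> E}"

text \<open>For \<open>c = 0\<close> the condition is vacuous, so that problems without a
  connectivity requirement share \<open>good\<close>. Reachability by \<open>linked\<close> replaces
  paths because the cut arguments only need sets closed under links.\<close>

definition robustly_connected :: "nat \<Rightarrow> 'a set set \<Rightarrow> 'a set \<Rightarrow> bool" where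
  "robustly_connected c E S \<longleftrightarrow>
     (\<forall>U. U \<subseteq> S \<and> card U < c \<longrightarrow> (\<forall>u\<in>S - U. \<forall>v\<in>S - U. (u, v) \<in> (linked E (S - U))\<^sup>*))"

definition good :: "nat \<Rightarrow> nat \<Rightarrow> nat \<Rightarrow> 'a set set \<Rightarrow> 'a set \<Rightarrow> bool" where
  "good \<alpha> \<tau> c E S \<longleftrightarrow>
     (\<forall>u\<in>S. \<forall>v\<in>S. u \<noteq> v \<longrightarrow> pair_ok \<alpha> \<tau> E S u v) \<and> robustly_connected c E S"

lemma pair_ok_mono:
  assumes "pair_ok \<alpha> \<tau> E S u v" "S \<subseteq> H" "finite H"
  shows "pair_ok \<alpha> \<tau> E H u v"
proof -
  have "card (common E S u v) \<le> card (common E H u v)"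
    using assms(2,3) by (intro card_mono) (auto simp: common_def)
  then show ?thesis using assms(1) by (auto simp: pair_ok_def)
qed

lemma linked_sym: "(u, v) \<in> linked E S \<longleftrightarrow> (v, u) \<in> linked E S"
  by (auto simp: linked_def insert_commute)

lemma linked_rtrancl_sym: "(u, v) \<in> (linked E S)\<^sup>* \<Longrightarrow> (v, u) \<in> (linked E S)\<^sup>*"
proof -
  assume "(u, v) \<in> (linked E S)\<^sup>*"
  moreover have "(linked E S)\<inverse> = linked E S" using linked_sym by fastforce
  ultimately show ?thesis by (metis rtrancl_converseI)
qed

lemma path_imp_linked:
  assumes "p \<noteq> []" "set p \<subseteq> S" "successively (\<lambda>x y. {x, y} \<in> E \<and> {x, y} \<subseteq> S) p"
  shows "(hd p, last p) \<in> (linked E S)\<^sup>*"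
  using assms
proof (induction p rule: induct_list012)
  case (3 x y zs)
  then have "(x, y) \<in> linked E S" by (auto simp: linked_def)
  with 3 show ?case by (auto intro: converse_rtrancl_into_rtrancl)
qed auto

lemma linked_imp_path:
  assumes "(u, v) \<in> (linked E S)\<^sup>*" "u \<in> S"
  shows "\<exists>p. p \<noteq> [] \<and> hd p = u \<and> last p = v \<and> distinct p \<and> set p \<subseteq> S \<and>
    successively (\<lambda>x y. {x, y} \<in> E \<and> {x, y} \<subseteq> S) p"
  using assms
proof (induction rule: rtrancl_induct)
  case base
  then show ?case by (intro exI[of _ "[u]"]) auto
next
  case (step y z)
  then obtain p where p: "p \<noteq> []" "hd p = u" "last p = y" "distinct p" "set p \<subseteq> S"
    "successively (\<lambda>x y. {x, y} \<in> E \<and> {x, y} \<subseteq> S) p" by blast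
  have yz: "{y, z} \<in> E" "y \<in> S" "z \<in> S" using step(2) by (auto simp: linked_def)
  show ?case
  proof (cases "z \<in> set p")
    case True
    then obtain xs ys where split: "p = xs @ z # ys" by (meson split_list)
    have "successively (\<lambda>x y. {x, y} \<in> E \<and> {x, y} \<subseteq> S) (xs @ [z])"
      using p(6) unfolding split by (auto simp: successively_append_iff)
    moreover have "hd (xs @ [z]) = u" "distinct (xs @ [z])" "set (xs @ [z]) \<subseteq> S"
      using p(2,4,5) unfolding split by (auto simp: hd_append)
    ultimately show ?thesis by (intro exI[of _ "xs @ [z]"]) simp
  next
    case False
    then show ?thesis using p yz
      by (intro exI[of _ "p @ [z]"]) (auto simp: successively_append_iff)
  qed
qed

section \<open>Paths of length at most two as counts of common neighbours\<close>

context
  fixes G :: "'a graph" and S :: "'a set"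
  assumes G: "simple_graph G" and S: "S \<subseteq> verts G"
begin

lemma is_path_induced:
  "is_path (induced G S) u p v \<longleftrightarrow> p \<noteq> [] \<and> hd p = u \<and> last p = v \<and> distinct p \<and> set p \<subseteq> S \<and>
     successively (\<lambda>x y. {x, y} \<in> edges G \<and> {x, y} \<subseteq> S) p"
  using S by (auto simp: is_path_def induced_def)

lemma finite_sub: "finite S"
  using G S by (auto simp: simple_graph_def intro: finite_subset)

lemma no_loop: "{x, x} \<notin> edges G" "{x} \<notin> edges G"
  using G by (auto simp: simple_graph_def)

lemma graph_connected_induced:
  "graph_connected (induced G S) \<longleftrightarrow> (\<forall>u\<in>S. \<forall>v\<in>S. (u, v) \<in> (linked (edges G) S)\<^sup>*)"
proof -
  have "(\<exists>p. is_path (induced G S) u p v) \<longleftrightarrow> (u, v) \<in> (linked (edges G) S)\<^sup>*" if "u \<in> S" for u v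
    using path_imp_linked[of _ S "edges G"] linked_imp_path[of u v "edges G" S] that
    by (auto simp: is_path_induced)
  moreover have "verts (induced G S) = S" using S by (auto simp: induced_def)
  ultimately show ?thesis by (auto simp: graph_connected_def)
qed

lemma short_path_iff:
  assumes "u \<in> S" "v \<in> S" "u \<noteq> v"
  shows "is_path (induced G S) u p v \<and> path_length p \<le> 2 \<longleftrightarrow>
    p = [u, v] \<and> {u, v} \<in> edges G \<or> (\<exists>w\<in>common (edges G) S u v. p = [u, w, v])"
proof
  assume l: "is_path (induced G S) u p v \<and> path_length p \<le> 2"
  then obtain q where q: "p = u # q" unfolding is_path_induced by (cases p) auto
  from l q assms obtain x q' where q': "q = x # q'" unfolding is_path_induced by (cases q) auto
  show "p = [u, v] \<and> {u, v} \<in> edges G \<or> (\<exists>w\<in>common (edges G) S u v. p = [u, w, v])"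
  proof (cases q')
    case Nil
    with l q q' show ?thesis unfolding is_path_induced by auto
  next
    case (Cons y q'')
    with l q q' have "q'' = []" by (auto simp: path_length_def)
    with l q q' Cons show ?thesis unfolding is_path_induced common_def by auto
  qed
next
  assume "p = [u, v] \<and> {u, v} \<in> edges G \<or> (\<exists>w\<in>common (edges G) S u v. p = [u, w, v])"
  then show "is_path (induced G S) u p v \<and> path_length p \<le> 2"
    using assms no_loop unfolding is_path_induced common_def path_length_def
    by (elim disjE bexE) auto
qed

lemma two_club_iff:
  "two_club G S \<longleftrightarrow> (\<forall>u\<in>S. \<forall>v\<in>S. u \<noteq> v \<longrightarrow> pair_ok 1 1 (edges G) S u v)"
proof -
  have vs: "verts (induced G S) = S" using S by (auto simp: induced_def)
  \<comment> \<open>Over the empty index set the infimum is \<open>\<infinity>\<close>; otherwise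
    the gap between 2 and 3 provides the witness.\<close>
  have INF_le: "(INF p\<in>A. enat (f p)) \<le> 2 \<longleftrightarrow> (\<exists>p\<in>A. f p \<le> 2)" for A and f :: "'b \<Rightarrow> nat"
  proof
    assume l: "(INF p\<in>A. enat (f p)) \<le> 2"
    show "\<exists>p\<in>A. f p \<le> 2"
    proof (rule ccontr)
      assume "\<not> (\<exists>p\<in>A. f p \<le> 2)"
      then have "(3::enat) \<le> (INF p\<in>A. enat (f p))"
        by (intro INF_greatest) (auto simp: numeral_eq_enat not_le)
      then have "(3::enat) \<le> 2" using l by (rule order_trans)
      then show False by simp
    qed
  next
    assume "\<exists>p\<in>A. f p \<le> 2"
    then obtain p where p: "p \<in> A" "f p \<le> 2" by blast
    have "(INF p\<in>A. enat (f p)) \<le> enat (f p)" using p(1) by (rule INF_lower)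
    also have "\<dots> \<le> 2" using p(2) by (simp add: numeral_eq_enat)
    finally show "(INF p\<in>A. enat (f p)) \<le> 2" .
  qed
  have diag: "distance (induced G S) u u \<le> 2" if "u \<in> S" for u
    using that unfolding distance_def INF_le
    by (intro bexI[of _ "[u]"]) (auto simp: path_length_def is_path_induced)
  have "distance (induced G S) u v \<le> 2 \<longleftrightarrow> pair_ok 1 1 (edges G) S u v"
    if "u \<in> S" "v \<in> S" "u \<noteq> v" for u v
  proof -
    have fin: "finite (common (edges G) S u v)" using finite_sub by (auto simp: common_def)
    have "distance (induced G S) u v \<le> 2 \<longleftrightarrow> (\<exists>p. is_path (induced G S) u p v \<and> path_length p \<le> 2)"
      unfolding distance_def INF_le by auto
    also have "\<dots> \<longleftrightarrow> {u, v} \<in> edges G \<or> common (edges G) S u v \<noteq> {}"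
      unfolding short_path_iff[OF that] by auto
    also have "\<dots> \<longleftrightarrow> pair_ok 1 1 (edges G) S u v"
      using fin by (auto simp: pair_ok_def Suc_le_eq card_gt_0_iff)
    finally show ?thesis .
  qed
  with diag show ?thesis unfolding two_club_def graph_diameter_def vs SUP_le_iff by metis
qed

text \<open>Distinct paths of length at most two between the same ends are internally disjoint
  anyway, since each has at most one internal vertex and is determined by it. Disjointness thus
  comes for free, and any \<open>t\<close> of the short paths will do.\<close>

lemma robust_two_club_iff:
  "robust_two_club t G S \<longleftrightarrow> (\<forall>u\<in>S. \<forall>v\<in>S. u \<noteq> v \<longrightarrow> pair_ok 1 t (edges G) S u v)"
proof -
  have "(\<exists>P. finite P \<and> card P = t \<and>
             (\<forall>p\<in>P. is_path (induced G S) u p v \<and> path_length p \<le> 2) \<and>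
             disjoint_family_on internal_verts P) \<longleftrightarrow> pair_ok 1 t (edges G) S u v"
    if uv: "u \<in> S" "v \<in> S" "u \<noteq> v" for u v
  proof -
    define C where "C = common (edges G) S u v"
    define A where "A = (if {u, v} \<in> edges G then {[u, v]} else {}) \<union> (\<lambda>w. [u, w, v]) ` C"
    have finC: "finite C" using finite_sub by (auto simp: C_def common_def)
    have finA: "finite A" using finC by (auto simp: A_def)
    have "card A = (if {u, v} \<in> edges G then 1 else 0) + card ((\<lambda>w. [u, w, v]) ` C)"
      unfolding A_def using finC by (subst card_Un_disjoint) auto
    also have "card ((\<lambda>w. [u, w, v]) ` C) = card C" by (intro card_image inj_onI) auto
    finally have cardA: "card A = (if {u, v} \<in> edges G then 1 else 0) + card C" .
    have A: "p \<in> A \<longleftrightarrow> is_path (induced G S) u p v \<and> path_length p \<le> 2" for p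
      unfolding short_path_iff[OF uv] A_def C_def by auto
    have disj: "disjoint_family_on internal_verts P" if "P \<subseteq> A" for P
    proof -
      have "internal_verts p \<inter> internal_verts q = {}" if "p \<in> A" "q \<in> A" "p \<noteq> q" for p q
        using that unfolding A_def internal_verts_def by (auto split: if_splits)
      then show ?thesis using that unfolding disjoint_family_on_def by blast
    qed
    have "pair_ok 1 t (edges G) S u v \<longleftrightarrow> t \<le> card A"
      unfolding pair_ok_def cardA C_def by simp
    also have "\<dots> \<longleftrightarrow> (\<exists>P. P \<subseteq> A \<and> finite P \<and> card P = t)"
      using finA by (meson card_mono obtain_subset_with_card_n)
    finally show ?thesis unfolding A[symmetric] using disj by blast
  qed
  then show ?thesis unfolding robust_two_club_def by blast
qed

end

text \<open>The most harmful deletion for a nonadjacent pair is the set of all its common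
  neighbours. It is a proper subset of \<open>S\<close>, because it contains neither end, and it is
  affordable if it has at most \<open>t\<close> elements. An edge survives every deletion that
  spares its ends, hence its worth \<open>t + 1\<close>.\<close>

lemma hereditary_two_club_iff:
  assumes G: "simple_graph G" and S: "S \<subseteq> verts G"
  shows "hereditary_two_club t G S \<longleftrightarrow>
    (\<forall>u\<in>S. \<forall>v\<in>S. u \<noteq> v \<longrightarrow> pair_ok (t + 1) (t + 1) (edges G) S u v)"
proof -
  note fin = finite_sub[OF G S]
  have finC: "finite (common (edges G) X u v)" if "X \<subseteq> S" for X u v
    using finite_subset[OF that fin] by (auto simp: common_def)
  have sub: "common (edges G) (S - U) u v = common (edges G) S u v - U" for U u v
    by (auto simp: common_def)
  have ok1: "pair_ok 1 1 (edges G) X u v \<longleftrightarrow> {u, v} \<in> edges G \<or> common (edges G) X u v \<noteq> {}"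
    if "X \<subseteq> S" for X u v
    using finC[OF that] by (auto simp: pair_ok_def Suc_le_eq card_gt_0_iff)
  show ?thesis
  proof
    assume h: "hereditary_two_club t G S"
    show "\<forall>u\<in>S. \<forall>v\<in>S. u \<noteq> v \<longrightarrow> pair_ok (t + 1) (t + 1) (edges G) S u v"
    proof (intro ballI impI, rule ccontr)
      fix u v assume uv: "u \<in> S" "v \<in> S" "u \<noteq> v"
        and bad: "\<not> pair_ok (t + 1) (t + 1) (edges G) S u v"
      define U where "U = common (edges G) S u v"
      have nadj: "{u, v} \<notin> edges G" and "card U \<le> t"
        using bad by (auto simp: pair_ok_def U_def split: if_splits)
      moreover have uvU: "u \<notin> U" "v \<notin> U" "U \<subseteq> S"
        using no_loop[OF G S] by (auto simp: U_def common_def)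
      ultimately have "two_club G (S - U)" using h uv by (auto simp: hereditary_two_club_def)
      then have "pair_ok 1 1 (edges G) (S - U) u v"
        using uv uvU S by (subst (asm) two_club_iff[OF G]) auto
      then show False using nadj by (subst (asm) ok1) (auto simp: sub U_def)
    qed
  next
    assume h: "\<forall>u\<in>S. \<forall>v\<in>S. u \<noteq> v \<longrightarrow> pair_ok (t + 1) (t + 1) (edges G) S u v"
    show "hereditary_two_club t G S" unfolding hereditary_two_club_def
    proof (intro allI impI)
      fix U assume U: "U \<subset> S \<and> card U \<le> t"
      then have finU: "finite U" using fin finite_subset by blast
      have "pair_ok 1 1 (edges G) (S - U) u v"
        if "u \<in> S - U" "v \<in> S - U" "u \<noteq> v" for u v
      proof (cases "{u, v} \<in> edges G")
        case False
        with h that have "card U < card (common (edges G) S u v)"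
          using U by (fastforce simp: pair_ok_def)
        then have "\<not> common (edges G) S u v \<subseteq> U" using finU card_mono leD by blast
        then show ?thesis by (subst ok1) (auto simp: sub)
      qed (simp add: pair_ok_def)
      moreover have "S - U \<subseteq> verts G" using S by blast
      ultimately show "two_club G (S - U)" unfolding two_club_iff[OF G \<open>S - U \<subseteq> verts G\<close>] by blast
    qed
  qed
qed

lemma hereditary_good:
  assumes "simple_graph G" "S \<subseteq> verts G"
  shows "hereditary_two_club t G S \<longleftrightarrow> good (t + 1) (t + 1) 0 (edges G) S"
  unfolding hereditary_two_club_iff[OF assms] by (simp add: good_def robustly_connected_def)

lemma robust_good:
  assumes "simple_graph G" "S \<subseteq> verts G"
  shows "robust_two_club t G S \<longleftrightarrow> good 1 t 0 (edges G) S"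
  unfolding robust_two_club_iff[OF assms] by (simp add: good_def robustly_connected_def)

lemma connected_good:
  assumes "simple_graph G" "S \<subseteq> verts G"
  shows "connected_two_club t G S \<longleftrightarrow> good 1 1 t (edges G) S \<and> t < card S"
proof -
  have "graph_connected (induced G (S - U)) \<longleftrightarrow>
      (\<forall>u\<in>S - U. \<forall>v\<in>S - U. (u, v) \<in> (linked (edges G) (S - U))\<^sup>*)" for U
    using assms(2) by (intro graph_connected_induced[OF assms(1)]) auto
  then show ?thesis
    by (simp add: connected_two_club_def two_club_iff[OF assms] good_def robustly_connected_def
        conj_ac)
qed

section \<open>Programs with registers and arrays\<close>

text \<open>
  Machine register \<open>0\<close> holds the length of the input. Behind the input there are \<open>stride\<close> interleaved
  arrays, all of unbounded length.
\<close>

definition stride :: nat where "stride = 10"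

text \<open>The machine cannot multiply; a constant factor is unrolled into additions.\<close>

fun times :: "nat \<Rightarrow> aexp \<Rightarrow> aexp" where
  "times 0 e = Const 0"
| "times (Suc k) e = Add e (times k e)"

definition V :: "nat \<Rightarrow> aexp" where "V x = Reg (Suc x)"
definition cell :: "nat \<Rightarrow> aexp \<Rightarrow> aexp" where
  "cell j e = Add (Reg 0) (Add (times stride e) (Const j))"
definition A :: "nat \<Rightarrow> aexp \<Rightarrow> aexp" where "A j e = Mem (cell j e)"
definition set_reg :: "nat \<Rightarrow> aexp \<Rightarrow> com" (infix ":=:" 64) where "x :=: e = Assign (Suc x) e"
definition put :: "nat \<Rightarrow> aexp \<Rightarrow> aexp \<Rightarrow> com" where "put j e v = Store (cell j e) v"

abbreviation seq_syntax :: "com \<Rightarrow> com \<Rightarrow> com" (infixr ";;" 60) where "c1 ;; c2 \<equiv> Seq c1 c2"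
abbreviation guarded :: "bexp \<Rightarrow> com \<Rightarrow> com" where "guarded b c \<equiv> Cond b c Skip"

text \<open>Steps for one pass through the program text, with both branches of a conditional and one
  round of every loop. It depends on the program alone and thus ends up in the constant of the
  O-notation.\<close>

fun csize :: "com \<Rightarrow> nat" where
  "csize Skip = 1"
| "csize (Assign r a) = 1 + acost a"
| "csize (Store a b) = 1 + acost a + acost b"
| "csize (Seq c1 c2) = csize c1 + csize c2"
| "csize (Cond b c1 c2) = 1 + bcost b + csize c1 + csize c2"
| "csize (While b c) = 1 + bcost b + csize c"

lemma aval_times [simp]: "aval (times k e) s = k * aval e s"
  by (induction k) auto

type_synonym regs = "nat \<Rightarrow> nat"
type_synonym arrays = "nat \<Rightarrow> nat \<Rightarrow> nat"

section \<open>Machine states seen as registers and arrays, and a logic for iteration counts\<close>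

locale ram_view =
  fixes B :: nat and inp :: "nat \<Rightarrow> nat"
begin

text \<open>Addresses below \<open>B\<close> are fixed to the input: \<open>put\<close> only writes
  at or above \<open>B\<close>, so the adjacency lists stay readable throughout.\<close>

definition emb :: "regs \<Rightarrow> arrays \<Rightarrow> state" where
  "emb r a = (case_nat B r,
     \<lambda>x. if x < B then inp x else a ((x - B) mod stride) ((x - B) div stride))"

lemma cell_emb: "aval (cell j e) (emb r a) = B + (stride * aval e (emb r a) + j)"
  by (simp add: cell_def emb_def)

lemma aval_V [simp]: "aval (V x) (emb r a) = r x"
  by (simp add: V_def emb_def)

lemma aval_A [simp]: "j < 10 \<Longrightarrow> aval (A j e) (emb r a) = a j (aval e (emb r a))"
  unfolding A_def aval.simps cell_emb by (simp add: emb_def stride_def)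

lemma input_emb [simp]: "x < B \<Longrightarrow> snd (emb r a) x = inp x"
  by (simp add: emb_def)

lemma emb_upd: "(fst (emb r a))(Suc x := v) = fst (emb (r(x := v)) a)"
  "snd (emb (r(x := v)) a) = snd (emb r a)"
  by (auto simp: emb_def fun_eq_iff split: nat.split)

lemma emb_put:
  assumes "j < 10"
  shows "(snd (emb r a))(B + (stride * i + j) := v) = snd (emb r (a(j := (a j)(i := v))))"
proof
  fix x
  have "x = B + (stride * i + j) \<longleftrightarrow> \<not> x < B \<and> (x - B) mod stride = j \<and> (x - B) div stride = i"
    using assms mult_div_mod_eq[of stride "x - B"] by (auto simp: stride_def)
  then show "((snd (emb r a))(B + (stride * i + j) := v)) x = snd (emb r (a(j := (a j)(i := v)))) x"
    by (auto simp: emb_def)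
qed

text \<open>
  Up to the factor \<^term>\<open>csize c\<close>, the running time of a program \<open>c\<close> is the number \<open>N\<close> of loop
  iterations plus one.
\<close>

definition ht :: "com \<Rightarrow> regs \<Rightarrow> arrays \<Rightarrow> nat \<Rightarrow> (regs \<Rightarrow> arrays \<Rightarrow> bool) \<Rightarrow> bool" where
  "ht c r a N Q \<longleftrightarrow> (\<exists>T r' a'. exec c (emb r a) T (emb r' a') \<and> T \<le> csize c * (N + 1) \<and> Q r' a')"

lemma ht_mono:
  assumes "ht c r a N Q" "\<And>r' a'. Q r' a' \<Longrightarrow> Q' r' a'" "N \<le> N'"
  shows "ht c r a N' Q'"
proof -
  obtain T r' a' where "exec c (emb r a) T (emb r' a')" "T \<le> csize c * (N + 1)" "Q r' a'"
    using assms(1) by (auto simp: ht_def)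
  moreover have "csize c * (N + 1) \<le> csize c * (N' + 1)" using assms(3) by simp
  ultimately show ?thesis unfolding ht_def using assms(2) le_trans by blast
qed

lemma ht_result:
  "ht c r a M (\<lambda>r' a'. r' = r1 \<and> a' = a1) \<Longrightarrow> M \<le> N \<Longrightarrow> Q r1 a1 \<Longrightarrow> ht c r a N Q"
  by (erule ht_mono) auto

lemma ht_Skip: "Q r a \<Longrightarrow> ht Skip r a N Q"
  unfolding ht_def using exec.Skip[of "emb r a"] by force

lemma ht_set: "Q (r(x := aval e (emb r a))) a \<Longrightarrow> ht (x :=: e) r a N Q"
proof -
  assume Q: "Q (r(x := aval e (emb r a))) a"
  have "exec (x :=: e) (emb r a) (1 + acost e) (emb (r(x := aval e (emb r a))) a)"
    using exec.Assign[of "Suc x" e "emb r a"]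
    by (simp add: set_reg_def emb_upd prod_eq_iff[of "emb _ _"])
      (metis emb_upd(2) prod.collapse)
  with Q show ?thesis unfolding ht_def
    by (intro exI[of _ "1 + acost e"] exI[of _ "r(x := aval e (emb r a))"] exI[of _ a])
      (auto simp: set_reg_def)
qed

lemma ht_put:
  assumes "Q r (a(j := (a j)(aval i (emb r a) := aval e (emb r a))))" "j < 10"
  shows "ht (put j i e) r a N Q"
proof -
  have "exec (put j i e) (emb r a) (1 + acost (cell j i) + acost e)
      (emb r (a(j := (a j)(aval i (emb r a) := aval e (emb r a)))))"
    using exec.Store[of "cell j i" e "emb r a"]
    unfolding cell_emb emb_put[OF assms(2)] put_def by (simp add: emb_def)
  with assms(1) show ?thesis unfolding ht_def
    by (intro exI[of _ "1 + acost (cell j i) + acost e"] exI[of _ r] exI) (auto simp: put_def)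
qed

lemma ht_Seq:
  assumes "ht c1 r a N1 (\<lambda>r' a'. ht c2 r' a' N2 Q)" "N1 + N2 \<le> N"
  shows "ht (c1 ;; c2) r a N Q"
proof -
  obtain T1 r1 a1 where 1: "exec c1 (emb r a) T1 (emb r1 a1)" "T1 \<le> csize c1 * (N1 + 1)"
    "ht c2 r1 a1 N2 Q" using assms(1) unfolding ht_def by blast
  then obtain T2 r2 a2 where 2: "exec c2 (emb r1 a1) T2 (emb r2 a2)" "T2 \<le> csize c2 * (N2 + 1)"
    "Q r2 a2" unfolding ht_def by blast
  have "csize c1 * (N1 + 1) \<le> csize c1 * (N + 1)" "csize c2 * (N2 + 1) \<le> csize c2 * (N + 1)"
    using assms(2) by (auto intro: mult_le_mono)
  then have "T1 + T2 \<le> csize (c1 ;; c2) * (N + 1)"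
    using 1(2) 2(2) unfolding csize.simps distrib_right by linarith
  then show ?thesis unfolding ht_def using exec.Seq[OF 1(1) 2(1)] 2(3) by blast
qed

lemma ht_Seq0: "ht c1 r a 0 (\<lambda>r' a'. ht c2 r' a' N Q) \<Longrightarrow> ht (c1 ;; c2) r a N Q"
  by (erule ht_Seq) simp

lemma ht_Cond:
  assumes "bval b (emb r a) \<Longrightarrow> ht c1 r a N Q" "\<not> bval b (emb r a) \<Longrightarrow> ht c2 r a N Q"
  shows "ht (Cond b c1 c2) r a N Q"
proof (cases "bval b (emb r a)")
  case True
  then obtain T r' a' where "exec c1 (emb r a) T (emb r' a')" "T \<le> csize c1 * (N + 1)" "Q r' a'"
    using assms(1) by (auto simp: ht_def)
  then show ?thesis 
    unfolding ht_def using exec.CondTrue[OF True, of c1 T "emb r' a'" c2]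
    by (intro exI[of _ "1 + bcost b + T"] exI[of _ r'] exI[of _ a']) (auto simp: algebra_simps)
next
  case False
  then obtain T r' a' where "exec c2 (emb r a) T (emb r' a')" "T \<le> csize c2 * (N + 1)" "Q r' a'"
    using assms(2) by (auto simp: ht_def)
  then show ?thesis 
    unfolding ht_def using exec.CondFalse[OF False, of c2 T "emb r' a'" c1]
    by (intro exI[of _ "1 + bcost b + T"] exI[of _ r'] exI[of _ a']) (auto simp: algebra_simps)
qed

lemmas ht_intros = ht_Skip ht_set ht_put ht_Seq0 ht_Cond

text \<open>\<open>\<Phi>\<close> is a potential that pays for the remaining iterations, \<open>M\<close> bounds the cost of the body.\<close>

lemma ht_While:
  assumes "I r a" "\<Phi> r a \<le> N"
    and body: "\<And>r a. I r a \<Longrightarrow> bval b (emb r a) \<Longrightarrow>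
      ht c r a (M r a) (\<lambda>r' a'. I r' a' \<and> M r a + 1 + \<Phi> r' a' \<le> \<Phi> r a)"
    and exit: "\<And>r a. I r a \<Longrightarrow> \<not> bval b (emb r a) \<Longrightarrow> Q r a"
  shows "ht (While b c) r a N Q"
proof -
  have "ht (While b c) r a (\<Phi> r a) Q"
    using assms(1)
  proof (induction "\<Phi> r a" arbitrary: r a rule: less_induct)
    case less
    show ?case
    proof (cases "bval b (emb r a)")
      case False
      then show ?thesis using exit less.prems exec.WhileFalse[OF False, of c]
        unfolding ht_def
        by (intro exI[of _ "1 + bcost b"] exI[of _ r] exI[of _ a]) auto
    next
      case True
      obtain T1 r1 a1 where 1: "exec c (emb r a) T1 (emb r1 a1)" "T1 \<le> csize c * (M r a + 1)"
        "I r1 a1" "M r a + 1 + \<Phi> r1 a1 \<le> \<Phi> r a"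
        using body[OF less.prems True] by (auto simp: ht_def)
      have "ht (While b c) r1 a1 (\<Phi> r1 a1) Q" using 1 by (intro less.hyps) auto
      then obtain T2 r2 a2 where 2: "exec (While b c) (emb r1 a1) T2 (emb r2 a2)"
        "T2 \<le> csize (While b c) * (\<Phi> r1 a1 + 1)" "Q r2 a2" by (auto simp: ht_def)
      let ?C = "csize (While b c)"
      have "1 + bcost b + T1 \<le> ?C * (M r a + 1)" using 1(2) by (simp add: algebra_simps)
      then have "1 + bcost b + T1 + T2 \<le> ?C * ((M r a + 1) + (\<Phi> r1 a1 + 1))"
        using 2(2) unfolding distrib_left by linarith
      \<comment> \<open>Here the extra 1 by which the body must lower the potential is spent: it
        covers the guard and the constant part of the body.\<close>
      also have "\<dots> \<le> ?C * (\<Phi> r a + 1)" using 1(4) by (intro mult_le_mono) auto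
      finally show ?thesis unfolding ht_def using exec.WhileTrue[OF True 1(1) 2(1)] 2(3) by blast
    qed
  qed
  then show ?thesis using assms(2) ht_mono by blast
qed

end

section \<open>Disjoint paths as matchings\<close>

text \<open>
  Split every vertex \<open>y\<close> other than \<open>s\<close> and \<open>v\<close> into an outgoing and an incoming copy. Systems of
  disjoint paths from \<open>s\<close> to \<open>v\<close> correspond to matchings: \<open>f y\<close> is the vertex whose outgoing copy
  is matched to the incoming copy of \<open>y\<close>, where \<open>f y = y\<close> if no path uses \<open>y\<close>. There are \<open>j\<close> paths
  if \<open>s\<close> owns \<open>j\<close> vertices; then the outgoing copies of a set \<open>F\<close> of \<open>j\<close> vertices are matched to \<open>v\<close>.
\<close>

definition owner_map :: "'a set set \<Rightarrow> 'a set \<Rightarrow> 'a \<Rightarrow> 'a \<Rightarrow> ('a \<Rightarrow> 'a) \<Rightarrow> bool" where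
  "owner_map E H s v f \<longleftrightarrow>
     (\<forall>y\<in>H - {s, v}. f y \<in> H \<and> f y \<noteq> v \<and> (f y = y \<or> {f y, y} \<in> E))"

text \<open>Since \<open>s\<close> is not in \<open>H - {s, v}\<close>, the equation says that
  \<open>s\<close> is hit exactly \<open>j\<close> times, every vertex outside \<open>F\<close>
  exactly once, and nothing else at all; comparing sizes, \<open>F\<close> takes exactly
  \<open>j\<close> vertices out of \<open>H - {s, v}\<close>. As a multiset equation it ignores who
  owns what, so rerouting preserves it almost for free.\<close>

definition linkage :: "'a set set \<Rightarrow> 'a set \<Rightarrow> 'a \<Rightarrow> 'a \<Rightarrow> nat \<Rightarrow> ('a \<Rightarrow> 'a) \<Rightarrow> bool" where
  "linkage E H s v j f \<longleftrightarrow> (\<exists>F \<subseteq> {w. {w, v} \<in> E}.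
     image_mset f (mset_set (H - {s, v})) = mset_set (H - {s, v} - F) + replicate_mset j s)"

lemma linkage_id: "linkage E H s v 0 (\<lambda>y. y)"
  unfolding linkage_def by (rule exI[of _ "{}"]) simp

lemma image_mset_fun_upd:
  assumes "finite R" "y \<in> R"
  shows "image_mset (f(y := z)) (mset_set R) = image_mset f (mset_set R) - {#f y#} + {#z#}"
proof -
  have "image_mset (f(y := z)) (mset_set (R - {y})) = image_mset f (mset_set (R - {y}))"
    using assms by (intro image_mset_cong) auto
  then show ?thesis using mset_set.remove[OF assms] by simp
qed

text \<open>As a multiset, the image only loses \<open>f y\<close> and gains \<open>z\<close> on
  either side. With \<open>z = s\<close> this moves a provisional ownership of \<open>s\<close> from
  \<open>y\<close> one step back along an augmenting path.\<close>

lemma image_mset_swap: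
  assumes "finite R" "y \<in> R" "y' \<in> R" "y \<noteq> y'"
  shows "image_mset (f(y := f y', y' := z)) (mset_set R) = image_mset (f(y := z)) (mset_set R)"
  using assms
  by (simp add: image_mset_fun_upd)

text \<open>When \<open>s\<close> takes over \<open>y\<close>, the outgoing copy of
  \<open>f y\<close> becomes free and can be matched to \<open>v\<close>, so \<open>f y\<close>
  joins \<open>F\<close>. It was not in \<open>F\<close> before, because it occurs in the
  image.\<close>

lemma linkage_extend:
  assumes "linkage E H s v j f" "finite H" "y \<in> H - {s, v}" "f y \<noteq> s" "{f y, v} \<in> E"
  shows "linkage E H s v (Suc j) (f(y := s))"
proof -
  define R where "R = H - {s, v}"
  have R: "finite R" "y \<in> R" using assms(2,3) by (auto simp: R_def)
  obtain F where F: "F \<subseteq> {w. {w, v} \<in> E}"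
    "image_mset f (mset_set R) = mset_set (R - F) + replicate_mset j s"
    using assms(1) unfolding linkage_def R_def by blast
  have "f y \<in># image_mset f (mset_set R)" using R by simp
  then have fy: "f y \<in> R - F" unfolding F(2) using R(1) assms(4) by (simp split: if_splits)
  have "mset_set (R - F) = add_mset (f y) (mset_set (R - insert (f y) F))"
    using mset_set.remove[OF _ fy] R(1) by (simp add: Diff_insert[of R])
  then have "image_mset (f(y := s)) (mset_set R) =
      mset_set (R - insert (f y) F) + replicate_mset (Suc j) s"
    unfolding image_mset_fun_upd[OF R] F(2) by simp
  moreover have "insert (f y) F \<subseteq> {w. {w, v} \<in> E}" using F(1) assms(5) by simp
  ultimately show ?thesis unfolding linkage_def R_def by blast
qed

lemma card_owned:
  assumes "finite R" "image_mset f (mset_set R) = mset_set (R - F) + replicate_mset j s" "s \<in> X"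
  shows "card {y \<in> R. f y \<in> X} = card {y \<in> R - F. y \<in> X} + j"
proof -
  have "card {y \<in> R. f y \<in> X} = size (filter_mset (\<lambda>x. x \<in> X) (image_mset f (mset_set R)))"
    using assms(1) by (simp add: filter_mset_image_mset)
  also have "\<dots> = card {y \<in> R - F. y \<in> X} + j"
  proof -
    have "filter_mset (\<lambda>x. x \<in> X) (replicate_mset j s) = replicate_mset j s"
      using assms(3) by (induction j) auto
    then show ?thesis unfolding assms(2) using assms(1) by simp
  qed
  finally show ?thesis .
qed

text \<open>
  Counting the vertices owned by the component \<open>X\<close> of \<open>s\<close>: they lie in \<open>X \<union> U\<close>, but there
  are \<open>c\<close> more of them than vertices of \<open>X\<close> other than \<open>s\<close>.
\<close>

lemma linkage_imp_linked:
  assumes "finite H" "s \<in> H" "v \<in> H" "s \<noteq> v" "{s, v} \<notin> E"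
    and own: "owner_map E H s v f" and lnk: "linkage E H s v c f"
    and U: "U \<subseteq> H" "card U < c" "s \<notin> U" "v \<notin> U"
  shows "(s, v) \<in> (linked E (H - U))\<^sup>*"
proof (rule ccontr)
  assume nl: "(s, v) \<notin> (linked E (H - U))\<^sup>*"
  let ?R = "H - {s, v}"
  define X where "X = {x. (s, x) \<in> (linked E (H - U))\<^sup>*}"
  obtain F where F: "F \<subseteq> {w. {w, v} \<in> E}"
    "image_mset f (mset_set ?R) = mset_set (?R - F) + replicate_mset c s"
    using lnk by (auto simp: linkage_def)
  have sX: "s \<in> X" and vX: "v \<notin> X" using nl by (auto simp: X_def)
  have XH: "X \<subseteq> H - U"
  proof
    fix x assume "x \<in> X"
    then have "(s, x) \<in> (linked E (H - U))\<^sup>*" by (simp add: X_def)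
    then show "x \<in> H - U"
      by (induction rule: rtrancl_induct) (use assms in \<open>auto simp: linked_def\<close>)
  qed
  have closed: "y \<in> X" if "x \<in> X" "y \<in> H - U" "{x, y} \<in> E" for x y
    using that XH rtrancl_into_rtrancl[of s x "linked E (H - U)" y]
    by (auto simp: X_def linked_def)
  have "{y \<in> ?R. f y \<in> X} \<subseteq> (X - {s}) \<union> U"
  proof
    fix y assume y: "y \<in> {y \<in> ?R. f y \<in> X}"
    then have "f y = y \<or> {f y, y} \<in> E" using own by (auto simp: owner_map_def)
    then show "y \<in> (X - {s}) \<union> U" using y closed[of "f y" y] by auto
  qed
  then have "card {y \<in> ?R. f y \<in> X} \<le> card ((X - {s}) \<union> U)"
    using assms(1) XH U(1) by (intro card_mono) (auto intro: finite_subset)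
  also have "\<dots> \<le> card (X - {s}) + card U" by (rule card_Un_le)
  finally have 1: "card {y \<in> ?R. f y \<in> X} \<le> card (X - {s}) + card U" .
  \<comment> \<open>A vertex of \<open>F\<close> is adjacent to \<open>v\<close>, which lies outside
    \<open>X\<close> and \<open>U\<close>; so \<open>X\<close> and \<open>F\<close> are disjoint and
    every vertex of \<open>X\<close> except \<open>s\<close> is counted.\<close>
  have "X - {s} \<subseteq> {y \<in> ?R - F. y \<in> X}"
    using XH vX F(1) closed[of _ v] assms U by (auto simp: insert_commute)
  then have "card (X - {s}) \<le> card {y \<in> ?R - F. y \<in> X}"
    using assms(1) by (intro card_mono) auto
  with 1 card_owned[OF _ F(2) sX] assms(1) U(2) show False by simp
qed

text \<open>\<open>X\<close> is the set of outgoing copies found by a search that missed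
  \<open>v\<close>, and \<open>N\<close> the set of incoming copies it can enter. All of
  \<open>N\<close> is owned by \<open>X\<close>, which owns at most
  \<open>card (X - {s}) + j\<close> vertices. As \<open>N\<close> contains \<open>X - {s}\<close>,
  at most \<open>j\<close> vertices remain in the boundary \<open>N - X\<close>, and the part of the
  boundary inside \<open>S\<close> cuts \<open>s\<close> off from \<open>v\<close> in
  \<open>S\<close>.\<close>

lemma closed_imp_separated:
  assumes "finite H" "X \<subseteq> H" "s \<in> X" "v \<in> H" "v \<notin> X"
    and lnk: "linkage E H s v j f" and "j < c"
    and closed: "\<And>x y. x \<in> X \<Longrightarrow> y \<in> H \<Longrightarrow> y \<noteq> s \<Longrightarrow> y = x \<or> {x, y} \<in> E \<Longrightarrow> y \<noteq> v \<and> f y \<in> X"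
    and S: "S \<subseteq> H" "robustly_connected c E S" "s \<in> S" "v \<in> S"
  shows False
proof -
  let ?R = "H - {s, v}"
  obtain F where F: "image_mset f (mset_set ?R) = mset_set (?R - F) + replicate_mset j s"
    using lnk by (auto simp: linkage_def)
  define N where "N = {y \<in> H - {s}. \<exists>x\<in>X. y = x \<or> {x, y} \<in> E}"
  define U where "U = (N - X) \<inter> S"
  have fin: "finite N" "finite X" using assms(1,2) by (auto simp: N_def intro: finite_subset)
  have "N \<subseteq> {y \<in> ?R. f y \<in> X}" using closed by (auto simp: N_def)
  then have "card N \<le> card {y \<in> ?R. f y \<in> X}" using assms(1) by (intro card_mono) auto
  also have "\<dots> = card {y \<in> ?R - F. y \<in> X} + j" using card_owned[OF _ F assms(3)] assms(1) by simp
  also have "card {y \<in> ?R - F. y \<in> X} \<le> card (X - {s})" using fin by (intro card_mono) auto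
  finally have "card N \<le> card (X - {s}) + j" by simp
  moreover have "N = (N - X) \<union> (X - {s})" using assms(2,3) by (auto simp: N_def)
  then have "card N = card (N - X) + card (X - {s})"
    using card_Un_disjoint[of "N - X" "X - {s}"] fin by auto
  ultimately have "card (N - X) < c" using assms(7) by simp
  moreover have "card U \<le> card (N - X)" using fin by (auto simp: U_def intro: card_mono)
  ultimately have "card U < c" "U \<subseteq> S" by (auto simp: U_def)
  moreover have "s \<in> S - U" using S assms(3) by (auto simp: U_def)
  moreover have "v \<in> S - U" using S closed[of _ v] assms by (auto simp: U_def N_def)
  ultimately have "(s, v) \<in> (linked E (S - U))\<^sup>*"
    using S(2) unfolding robustly_connected_def by blast
  then have "v \<in> X"
  proof (induction rule: rtrancl_induct)
    case base
    then show ?case using assms(3) .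
  next
    case (step x y)
    then show ?case using S(1) assms(3) by (auto simp: linked_def U_def N_def)
  qed
  then show False using assms(5) by simp
qed

text \<open>The alternative \<open>C = H\<close> covers sets with less than \<open>c\<close>
  vertices, all of which then serve as sources.\<close>

lemma robustly_connectedI:
  assumes "finite H" "C \<subseteq> H" "C = H \<or> c \<le> card C"
    and "\<And>s v U. s \<in> C \<Longrightarrow> v \<in> H \<Longrightarrow> s \<noteq> v \<Longrightarrow> U \<subseteq> H \<Longrightarrow> card U < c \<Longrightarrow> s \<notin> U \<Longrightarrow> v \<notin> U \<Longrightarrow>
      (s, v) \<in> (linked E (H - U))\<^sup>*"
  shows "robustly_connected c E H"
  unfolding robustly_connected_def
proof (intro allI impI ballI)
  fix U u v assume U: "U \<subseteq> H \<and> card U < c" and u: "u \<in> H - U" and v: "v \<in> H - U"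
  have "\<exists>s\<in>C. s \<notin> U"
  proof (cases "C = H")
    case False
    then have "card U < card C" using assms(3) U by simp
    then have "\<not> C \<subseteq> U" using U assms(1) by (meson card_mono finite_subset leD)
    then show ?thesis by blast
  qed (use u in blast)
  then obtain s where s: "s \<in> C" "s \<notin> U" by blast
  have "(s, w) \<in> (linked E (H - U))\<^sup>*" if "w \<in> H - U" for w
    using assms(4)[of s w U] s U that by (cases "w = s") auto
  then show "(u, v) \<in> (linked E (H - U))\<^sup>*"
    using u v linked_rtrancl_sym rtrancl_trans by metis
qed

section \<open>Finding a pair with few common neighbours\<close>

text \<open>Working registers and arrays are numbered consecutively, so that what a phase may change
  is an interval such as \<open>{rFound..rV}\<close> or \<open>{aCount..aQueue}\<close>.\<close>

abbreviation (input) "rResult \<equiv> 2 :: nat"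
abbreviation (input) "rN \<equiv> 3 :: nat"
abbreviation (input) "rAlpha \<equiv> 4 :: nat"
abbreviation (input) "rTau \<equiv> 5 :: nat"
abbreviation (input) "rConn \<equiv> 6 :: nat"
abbreviation (input) "rSize \<equiv> 7 :: nat"
abbreviation (input) "rBudget \<equiv> 8 :: nat"
abbreviation (input) "rDepth \<equiv> 9 :: nat"
abbreviation (input) "rFound \<equiv> 10 :: nat"
abbreviation (input) "rFst \<equiv> 11 :: nat"
abbreviation (input) "rSnd \<equiv> 12 :: nat"
abbreviation (input) "rU \<equiv> 13 :: nat"
abbreviation (input) "rE \<equiv> 14 :: nat"
abbreviation (input) "rW \<equiv> 15 :: nat"
abbreviation (input) "rE2 \<equiv> 16 :: nat"
abbreviation (input) "rZ \<equiv> 17 :: nat"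
abbreviation (input) "rV \<equiv> 18 :: nat"
abbreviation (input) "rSources \<equiv> 19 :: nat"
abbreviation (input) "rJ \<equiv> 20 :: nat"
abbreviation (input) "rX \<equiv> 21 :: nat"
abbreviation (input) "rY \<equiv> 22 :: nat"
abbreviation (input) "rHead \<equiv> 23 :: nat"
abbreviation (input) "rTail \<equiv> 24 :: nat"
abbreviation (input) "rHit \<equiv> 25 :: nat"
abbreviation (input) "rRunning \<equiv> 26 :: nat"

abbreviation (input) "aDel \<equiv> 0 :: nat"
abbreviation (input) "aCount \<equiv> 2 :: nat"
abbreviation (input) "aOwner \<equiv> 3 :: nat"
abbreviation (input) "aOwned \<equiv> 4 :: nat"
abbreviation (input) "aParent \<equiv> 5 :: nat"
abbreviation (input) "aQueue \<equiv> 6 :: nat"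
abbreviation (input) "aFst \<equiv> 7 :: nat"
abbreviation (input) "aSnd \<equiv> 8 :: nat"
abbreviation (input) "aPhase \<equiv> 9 :: nat"

abbreviation "incr x \<equiv> x :=: Add (V x) (Const 1)"
abbreviation "eqc x c \<equiv> Equal (V x) (Const c)"
abbreviation "active x \<equiv> Equal (A aDel (V x)) (Const 0)"
abbreviation "adj_start x \<equiv> Mem (Add (Const 3) (V x))"
abbreviation "adj_end x \<equiv> Mem (Add (Const 4) (V x))"

definition fill :: "nat \<Rightarrow> aexp \<Rightarrow> com" where
  "fill j e = rZ :=: Const 0 ;; While (Less (V rZ) (V rN)) (put j (V rZ) e ;; incr rZ)"

definition count_row :: com where
  "count_row = rE2 :=: adj_start rW ;;
     While (Less (V rE2) (adj_end rW))
       (put aCount (Mem (V rE2)) (Add (A aCount (Mem (V rE2))) (Const 1)) ;; incr rE2)"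

text \<open>Counting proceeds from the middle vertex of each path, so no adjacency test is needed
  and one run costs only the degrees of the neighbours of \<open>rU\<close>. Counts of deleted
  vertices are raised as well, but \<open>scan_counts\<close> ignores them.\<close>

definition count_paths :: com where
  "count_paths = rE :=: adj_start rU ;;
     While (Less (V rE) (adj_end rU))
       (rW :=: Mem (V rE) ;;
        guarded (active rW) (put aCount (V rW) (Add (A aCount (V rW)) (V rAlpha)) ;; count_row) ;;
        incr rE)"

definition scan_counts :: com where
  "scan_counts = rV :=: Const 0 ;;
     While (Conj (eqc rFound 0) (Less (V rV) (V rN)))
       (guarded (Conj (active rV) (Conj (Neg (Equal (V rV) (V rU))) (Less (A aCount (V rV)) (V rTau))))
          (rFound :=: Const 1 ;; rFst :=: V rU ;; rSnd :=: V rV) ;;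
        incr rV)"

text \<open>For \<open>\<tau> = 0\<close> no pair is bad and the loop is skipped. Running it could
  take time quadratic in \<open>n\<close>, because then the absence of bad pairs does not bound the
  number of active vertices.\<close>

definition check_pairs :: com where
  "check_pairs = rU :=: Const 0 ;;
     While (Conj (eqc rFound 0) (Conj (Less (V rU) (V rN)) (Less (Const 0) (V rTau))))
       (guarded (active rU) (fill aCount (Const 0) ;; count_paths ;; scan_counts) ;; incr rU)"

abbreviation agree :: "'a set \<Rightarrow> ('a \<Rightarrow> 'b) \<Rightarrow> ('a \<Rightarrow> 'b) \<Rightarrow> bool" where
  "agree X f g \<equiv> \<forall>x. x \<notin> X \<longrightarrow> g x = f x"

section \<open>Adjacency lists in memory and the cost of counting common neighbours\<close>

locale graph_input = ram_view B inp for B inp +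
  fixes n m :: nat and E :: "nat set set"
  assumes addr: "4 + n \<le> B"
    and range: "u < n \<Longrightarrow> inp (3 + u) \<le> inp (4 + u) \<and> inp (4 + u) \<le> B"
    and inj: "u < n \<Longrightarrow> inj_on inp {inp (3 + u)..<inp (4 + u)}"
    and nbrs: "u < n \<Longrightarrow> inp ` {inp (3 + u)..<inp (4 + u)} = {v. {u, v} \<in> E}"
    and edge: "e \<in> E \<Longrightarrow> e \<subseteq> {..<n} \<and> card e = 2"
    and degs: "(\<Sum>u<n. inp (4 + u) - inp (3 + u)) \<le> 2 * m"
begin

abbreviation "deg u \<equiv> inp (4 + u) - inp (3 + u)"
abbreviation "alive a \<equiv> {i. i < n \<and> a aDel i = (0::nat)}"

lemma edgeD: "{u, v} \<in> E \<Longrightarrow> u < n \<and> v < n \<and> u \<noteq> v"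
  using edge[of "{u, v}"] by (auto simp: card_insert_if split: if_splits)

lemma deg_pos: "{u, v} \<in> E \<Longrightarrow> 0 < deg u"
proof -
  assume uv: "{u, v} \<in> E"
  then have "v \<in> inp ` {inp (3 + u)..<inp (4 + u)}" using nbrs[of u] edgeD by blast
  then show ?thesis by auto
qed

lemma nbr_inp:
  assumes "u < n" "inp (3 + u) \<le> e" "e < inp (4 + u)"
  shows "e < B" "inp e < n" "{u, inp e} \<in> E"
proof -
  show "e < B" using range[of u] assms by simp
  have "inp e \<in> inp ` {inp (3 + u)..<inp (4 + u)}" using assms by simp
  then show "{u, inp e} \<in> E" using nbrs[of u] assms(1) by blast
  then show "inp e < n" using edgeD by blast
qed

lemma deg_le: "u < n \<Longrightarrow> deg u \<le> 2 * m"
  using degs member_le_sum[of u "{..<n}" deg] by simp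

lemma sum_nbrs:
  assumes "u < n"
  shows "(\<Sum>e\<in>{inp (3 + u)..<inp (4 + u)}. g (inp e)) = (\<Sum>v\<in>{v. {u, v} \<in> E}. g v)"
  using sum.reindex[OF inj[OF assms], of g] nbrs[OF assms] by simp

lemma ht_fill:
  assumes "\<And>r a i. aval e (emb (r(rZ := i)) a) = g i" "r rN = n" "j < 10" "n \<le> N"
    and Q: "\<And>f. \<forall>i<n. f i = g i \<Longrightarrow> Q (r(rZ := n)) (a(j := f))"
  shows "ht (fill j e) r a N Q"
  unfolding fill_def
proof (intro ht_Seq0 ht_set, rule ht_While[where M = "\<lambda>_ _. 0" and \<Phi> = "\<lambda>r a. n - r rZ"
      and I = "\<lambda>r' a'. \<exists>i f. r' = r(rZ := i) \<and> a' = a(j := f) \<and> i \<le> n \<and> (\<forall>k<i. f k = g k)"],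
    goal_cases)
  case 1
  show ?case by (intro exI[of _ 0] exI[of _ "a j"]) simp
next
  case 2
  then show ?case using assms by simp
next
  case (3 r' a')
  then obtain i f where i: "r' = r(rZ := i)" "a' = a(j := f)" "i \<le> n" "\<forall>k<i. f k = g k" by blast
  have "i < n" using 3(2) assms(2) unfolding i by simp
  then show ?case unfolding i using i(4) assms(1)[of r i]
    by (intro ht_intros assms(3))
      (auto intro!: exI[of _ "Suc i"] exI[of _ "f(i := g i)"] simp: less_Suc_eq)
next
  case (4 r' a')
  then obtain i f where i: "r' = r(rZ := i)" "a' = a(j := f)" "i \<le> n" "\<forall>k<i. f k = g k" by blast
  have "i = n" using 4(2) i(3) assms(2) unfolding i by simp
  then show ?case using Q[of f] i by simp
qed

lemma ht_count_row:
  assumes w: "r rW = w" "w < n" and N: "deg w \<le> N"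
    and Q: "Q (r(rE2 := inp (4 + w))) (a(aCount := \<lambda>z. a aCount z + of_bool ({w, z} \<in> E)))"
  shows "ht count_row r a N Q"
proof -
  let ?f = "\<lambda>i z. a aCount z + of_bool (z \<in> inp ` {inp (3 + w)..<i})"
  have addrs: "3 + w < B" "4 + w < B" using addr w by auto
  show ?thesis
    unfolding count_row_def
  proof (intro ht_Seq0 ht_set, rule ht_While[where M = "\<lambda>_ _. 0"
        and \<Phi> = "\<lambda>r a. inp (4 + w) - r rE2"
        and I = "\<lambda>r' a'. \<exists>i. r' = r(rE2 := i) \<and> a' = a(aCount := ?f i) \<and>
           inp (3 + w) \<le> i \<and> i \<le> inp (4 + w)"], goal_cases)
    case 1
    show ?case using range[of w] w addrs by (intro exI[of _ "inp (3 + w)"]) simp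
  next
    case 2
    then show ?case using assms addrs by simp
  next
    case (3 r' a')
    then obtain i where i: "r' = r(rE2 := i)" "a' = a(aCount := ?f i)"
      "inp (3 + w) \<le> i" "i \<le> inp (4 + w)" by blast
    have lt: "i < inp (4 + w)" using 3(2) w addrs unfolding i by simp
    note nb = nbr_inp[OF w(2) i(3) lt]
    \<comment> \<open>No neighbour is listed twice, so this is the first and only increment of its
      counter.\<close>
    have "inp i \<notin> inp ` {inp (3 + w)..<i}"
    proof
      assume "inp i \<in> inp ` {inp (3 + w)..<i}"
      then obtain k where "inp i = inp k" "inp (3 + w) \<le> k" "k < i" by auto
      then show False using inj_onD[OF inj[OF w(2)], of i k] lt i(3) by auto
    qed
    moreover have "{inp (3 + w)..<Suc i} = insert i {inp (3 + w)..<i}" using i(3) by auto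
    ultimately have "?f (Suc i) = (?f i)(inp i := ?f i (inp i) + 1)" by auto
    then show ?case unfolding i using nb lt i(3)
      by (intro ht_intros) (auto intro!: exI[of _ "Suc i"])
  next
    case (4 r' a')
    then obtain i where i: "r' = r(rE2 := i)" "a' = a(aCount := ?f i)"
      "inp (3 + w) \<le> i" "i \<le> inp (4 + w)" by blast
    have "i = inp (4 + w)" using 4(2) w addrs i(4) unfolding i by simp
    then show ?case using Q nbrs[OF w(2)] i by simp
  qed
qed

lemma ht_count_paths:
  assumes u: "r rU = u" "u < n" and N: "4 * m \<le> N"
    and Q: "\<And>r'. agree {rE, rW, rE2} r r' \<Longrightarrow> Q r' (a(aCount := \<lambda>z. a aCount z +
      (\<Sum>w | {u, w} \<in> E \<and> a aDel w = 0. of_bool (z = w) * r rAlpha + of_bool ({w, z} \<in> E))))"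
  shows "ht count_paths r a N Q"
proof -
  let ?g = "\<lambda>z w. if a aDel w = 0 then of_bool (z = w) * r rAlpha + of_bool ({w, z} \<in> E) else 0"
  let ?f = "\<lambda>i z. a aCount z + (\<Sum>k\<in>{inp (3 + u)..<i}. ?g z (inp k))"
  let ?\<Phi> = "\<lambda>i. \<Sum>k\<in>{i..<inp (4 + u)}. deg (inp k) + 1"
  have addrs: "3 + u < B" "4 + u < B" using addr u by auto
  have fin: "finite {v. {u, v} \<in> E}" using edgeD by (auto intro: finite_subset[of _ "{..<n}"])
  have "(\<Sum>v | {u, v} \<in> E. deg v) \<le> (\<Sum>v<n. deg v)" using edgeD by (intro sum_mono2) auto
  \<comment> \<open>A neighbour of \<open>u\<close> costs its degree plus 1 for the outer round. The
    degrees sum to at most \<open>2 * m\<close>, and so do the ones, which sum to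
    \<open>deg u\<close>.\<close>
  then have \<Phi>0: "?\<Phi> (inp (3 + u)) \<le> N"
    using sum_nbrs[OF u(2), of deg] deg_le[OF u(2)] degs N by (simp add: sum_Suc)
  show ?thesis
    unfolding count_paths_def
  proof (intro ht_Seq0 ht_set, rule ht_While[where M = "\<lambda>r a. deg (inp (r rE))"
        and \<Phi> = "\<lambda>r a. ?\<Phi> (r rE)"
        and I = "\<lambda>r' a'. agree {rE, rW, rE2} r r' \<and> a' = a(aCount := ?f (r' rE)) \<and>
           inp (3 + u) \<le> r' rE \<and> r' rE \<le> inp (4 + u)"], goal_cases)
    case 1
    show ?case using range[of u] u addrs by simp
  next
    case 2
    then show ?case using \<Phi>0 addrs u by simp
  next
    case (3 r' a')
    then have i: "agree {rE, rW, rE2} r r'" "a' = a(aCount := ?f (r' rE))" "inp (3 + u) \<le> r' rE"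
      by auto
    have lt: "r' rE < inp (4 + u)" using 3 u addrs by simp
    note nb = nbr_inp[OF u(2) i(3) lt]
    have ins: "{inp (3 + u)..<Suc (r' rE)} = insert (r' rE) {inp (3 + u)..<r' rE}" using i(3) by auto
    have "?\<Phi> (r' rE) = deg (inp (r' rE)) + 1 + ?\<Phi> (Suc (r' rE))"
      using lt by (simp add: sum.atLeast_Suc_lessThan)
    then show ?case using i lt nb
      apply -
      apply (rule ht_Seq0, rule ht_set, rule ht_Seq[where ?N2.0 = 0])
       apply (rule ht_Cond)
        apply (intro ht_Seq0 ht_put)
         apply (rule ht_count_row)
            apply (auto intro!: ht_intros simp: ins fun_eq_iff)
      done
  next
    case (4 r' a')
    then have "agree {rE, rW, rE2} r r'" "a' = a(aCount := ?f (r' rE))" "r' rE = inp (4 + u)"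
      using u addrs by auto
    moreover have "(\<Sum>k\<in>{inp (3 + u)..<inp (4 + u)}. ?g z (inp k)) =
        (\<Sum>w | {u, w} \<in> E \<and> a aDel w = 0. of_bool (z = w) * r rAlpha + of_bool ({w, z} \<in> E))" for z
      using sum_nbrs[OF u(2), of "?g z"] sum.inter_filter[OF fin, symmetric] by (simp cong: conj_cong)
    ultimately show ?case using Q by simp
  qed
qed


lemma ht_scan_counts:
  assumes r: "r rN = n" "r rFound = 0" and N: "n \<le> N"
    and Q0: "\<And>r'. agree {rFound, rFst, rSnd, rV} r r' \<Longrightarrow> r' rFound = 0 \<Longrightarrow>
      (\<And>v. v \<in> alive a \<Longrightarrow> v \<noteq> r rU \<Longrightarrow> r rTau \<le> a aCount v) \<Longrightarrow> Q r' a"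
    and Q1: "\<And>r'. agree {rFound, rFst, rSnd, rV} r r' \<Longrightarrow> r' rFound = 1 \<Longrightarrow> r' rFst = r rU \<Longrightarrow>
      r' rSnd \<in> alive a \<Longrightarrow> r' rSnd \<noteq> r rU \<Longrightarrow> a aCount (r' rSnd) < r rTau \<Longrightarrow> Q r' a"
  shows "ht scan_counts r a N Q"
  unfolding scan_counts_def
proof (intro ht_Seq0 ht_set, rule ht_While[where M = "\<lambda>_ _. 0" and \<Phi> = "\<lambda>r a. n - r rV"
      and I = "\<lambda>r' a'. agree {rFound, rFst, rSnd, rV} r r' \<and> a' = a \<and> r' rV \<le> n \<and>
        (r' rFound = 0 \<and> (\<forall>v. v \<in> alive a \<and> v < r' rV \<and> v \<noteq> r rU \<longrightarrow> r rTau \<le> a aCount v) \<or>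
         r' rFound = 1 \<and> r' rFst = r rU \<and> r' rSnd \<in> alive a \<and> r' rSnd \<noteq> r rU \<and>
           a aCount (r' rSnd) < r rTau)"], goal_cases)
  case 1
  show ?case using r by simp
next
  case 2
  then show ?case using N by simp
next
  case (3 r' a')
  then show ?case using r by (intro ht_intros) (auto simp: less_Suc_eq)
next
  case (4 r' a')
  then show ?case using r by (auto intro: Q0 Q1)
qed

text \<open>As \<open>\<tau>\<close> is positive, every vertex of \<open>H\<close> other than
  \<open>u\<close> has an edge, to \<open>u\<close> or to a common neighbour. The degrees, taken in
  the whole graph, sum to at most \<open>2 * m\<close>; the extra 1 is \<open>u\<close>
  itself.\<close>

lemma card_alive_le:
  assumes H: "H \<subseteq> {..<n}" "u \<in> H" "0 < \<tau>"
    and ok: "\<And>v. v \<in> H \<Longrightarrow> v \<noteq> u \<Longrightarrow> pair_ok \<alpha> \<tau> E H u v"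
  shows "card H \<le> 2 * m + 1"
proof -
  have fin: "finite H" using H finite_subset by blast
  have pos: "1 \<le> deg v" if "v \<in> H - {u}" for v
  proof -
    have "{u, v} \<in> E \<or> common E H u v \<noteq> {}"
      using ok[of v] that H(3) by (auto simp: pair_ok_def split: if_splits)
    then obtain w where "{v, w} \<in> E" by (auto simp: common_def insert_commute)
    then show ?thesis using deg_pos by (simp add: Suc_le_eq)
  qed
  have "card (H - {u}) = (\<Sum>v\<in>H - {u}. 1)" by simp
  also have "\<dots> \<le> (\<Sum>v\<in>H - {u}. deg v)" using pos by (rule sum_mono)
  also have "\<dots> \<le> (\<Sum>v<n. deg v)" using H by (intro sum_mono2) auto
  finally show ?thesis using degs fin H(2) by (simp add: card_Diff_singleton)
qed

text \<open>One full round costs \<open>n\<close> for clearing, \<open>4 * m\<close> for counting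
  and \<open>n\<close> for scanning. If \<open>H\<close> has more than \<open>2 * m + 1\<close>
  vertices, the first full round already finds a bad pair, so there is just one.\<close>

definition pairs_cost :: "nat set \<Rightarrow> nat" where
  "pairs_cost H = n + (2 * n + 4 * m) * (if card H \<le> 2 * m + 1 then card H else 1)"

lemma count_value:
  assumes "u < n" "v \<noteq> u" "H = alive a" "v \<in> H"
  shows "(\<Sum>w | {u, w} \<in> E \<and> a aDel w = 0. of_bool (v = w) * \<alpha> + of_bool ({w, v} \<in> E))
    = (if {u, v} \<in> E then \<alpha> else 0) + card (common E H u v)"
proof -
  let ?W = "{w. {u, w} \<in> E \<and> a aDel w = 0}"
  have fin: "finite ?W" using edgeD by (auto intro: finite_subset[of _ "{..<n}"])
  have "(\<Sum>w\<in>?W. of_bool (v = w) * \<alpha>) = (\<Sum>w\<in>?W. if v = w then \<alpha> else 0)"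
    by (intro sum.cong) auto
  also have "\<dots> = (if {u, v} \<in> E then \<alpha> else 0)"
    using fin assms by (simp add: sum.delta')
  finally have 1: "(\<Sum>w\<in>?W. of_bool (v = w) * \<alpha>) = (if {u, v} \<in> E then \<alpha> else 0)" .
  have "common E H u v = {w \<in> ?W. {w, v} \<in> E}"
    using assms(3) edgeD by (auto simp: common_def)
  then have "(\<Sum>w\<in>?W. of_bool ({w, v} \<in> E)) = card (common E H u v)"
    using fin by (simp add: sum.inter_filter[symmetric] of_bool_def)
  with 1 show ?thesis by (simp add: sum.distrib)
qed

lemma ht_check_pairs:
  assumes r: "r rN = n" "r rFound = 0" "r rAlpha = \<alpha>" "r rTau = \<tau>" and H: "alive a = H"
    and N: "pairs_cost H \<le> N"
    and Q0: "\<And>r' a'. agree {rFound..rV} r r' \<Longrightarrow> agree {aCount} a a' \<Longrightarrow> r' rFound = 0 \<Longrightarrow>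
      (\<And>u v. u \<in> H \<Longrightarrow> v \<in> H \<Longrightarrow> u \<noteq> v \<Longrightarrow> pair_ok \<alpha> \<tau> E H u v) \<Longrightarrow> Q r' a'"
    and Q1: "\<And>r' a'. agree {rFound..rV} r r' \<Longrightarrow> agree {aCount} a a' \<Longrightarrow> r' rFound = 1 \<Longrightarrow>
      r' rFst \<in> H \<Longrightarrow> r' rSnd \<in> H \<Longrightarrow> r' rFst \<noteq> r' rSnd \<Longrightarrow>
      \<not> pair_ok \<alpha> \<tau> E H (r' rFst) (r' rSnd) \<Longrightarrow> Q r' a'"
  shows "ht check_pairs r a N Q"
proof -
  let ?D = "2 * n + 4 * m"
  \<comment> \<open>The number of full rounds still to be paid for when the loop stands at vertex
    \<open>u\<close>.\<close>
  let ?\<kappa> = "\<lambda>u. if card H \<le> 2 * m + 1 then card {w \<in> H. u \<le> w} else 1"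
  let ?bad = "\<lambda>r'. r' rFound = 1 \<and> r' rFst \<in> H \<and> r' rSnd \<in> H \<and> r' rFst \<noteq> r' rSnd \<and>
     \<not> pair_ok \<alpha> \<tau> E H (r' rFst) (r' rSnd)"
  let ?ok = "\<lambda>u. u \<in> H \<longrightarrow> (\<forall>v\<in>H. u \<noteq> v \<longrightarrow> pair_ok \<alpha> \<tau> E H u v)"
  let ?\<Phi> = "\<lambda>r'. if r' rFound = 0 then n - r' rU + ?D * ?\<kappa> (r' rU) else 0"
  let ?M = "\<lambda>r' :: regs. if r' rU \<in> H then ?D else 0"
  let ?I = "\<lambda>r' a'. agree {rFound..rV} r r' \<and> agree {aCount} a a' \<and>
     (r' rFound = 0 \<and> (\<forall>u < r' rU. ?ok u) \<or> ?bad r')"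
  have Hn: "H \<subseteq> {..<n}" "finite H" using H by auto
  have step: "n - u + ?D * ?\<kappa> u \<ge> ?D + 1 + (n - Suc u + ?D * ?\<kappa> (Suc u))"
    if "u \<in> H" "card H \<le> 2 * m + 1" for u
  proof -
    have "{w \<in> H. u \<le> w} = insert u {w \<in> H. Suc u \<le> w}" using that by auto
    then have "card {w \<in> H. u \<le> w} = Suc (card {w \<in> H. Suc u \<le> w})" using Hn by simp
    moreover have "u < n" using that Hn by auto
    ultimately show ?thesis using that by simp
  qed
  have step': "n - u + ?D * ?\<kappa> u \<ge> 1 + (n - Suc u + ?D * ?\<kappa> (Suc u))" if "u < n" for u
  proof -
    have "card {w \<in> H. Suc u \<le> w} \<le> card {w \<in> H. u \<le> w}" using Hn by (intro card_mono) auto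
    then have "?D * ?\<kappa> (Suc u) \<le> ?D * ?\<kappa> u" by (intro mult_le_mono) auto
    then show ?thesis using that by linarith
  qed
  have stop: "n - u + ?D * ?\<kappa> u \<ge> ?D + 1" if "u \<in> H" for u
  proof -
    have "0 < card {w \<in> H. u \<le> w}" using that Hn by (auto simp: card_gt_0_iff)
    then have "?D * 1 \<le> ?D * ?\<kappa> u" by (intro mult_le_mono) (auto simp: Suc_le_eq)
    moreover have "1 \<le> n - u" using that Hn by auto
    ultimately have "1 + ?D * 1 \<le> n - u + ?D * ?\<kappa> u" by (intro add_mono)
    then show ?thesis by simp
  qed
  show ?thesis
    unfolding check_pairs_def
  proof (intro ht_Seq0 ht_set, rule ht_While[where M = "\<lambda>r a. ?M r" and \<Phi> = "\<lambda>r a. ?\<Phi> r" and I = ?I],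
      goal_cases)
    case 1
    show ?case using r by simp
  next
    case 2
    then show ?case using N r unfolding pairs_cost_def by (cases "card H \<le> 2 * m + 1") auto
  next
    case (3 r' a')
    then have I: "agree {rFound..rV} r r'" "agree {aCount} a a'" "r' rFound = 0" "\<forall>u < r' rU. ?ok u"
      and lt: "r' rU < n" "0 < \<tau>" using r by auto
    have alive: "alive a' = H" and reg: "r' rN = n" "r' rAlpha = \<alpha>" "r' rTau = \<tau>"
      using I H r by auto
    show ?case
    proof (cases "r' rU \<in> H")
      case False
      then have "\<not> bval (active rU) (emb r' a')" using alive lt by auto
      then show ?thesis using False I step'[OF lt(1)]
        by (intro ht_intros) (auto simp: less_Suc_eq)
    next
      case True
      have cnt: "(if {r' rU, v} \<in> E then \<alpha> else 0) + card (common E H (r' rU) v) =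
         (\<Sum>w | {r' rU, w} \<in> E \<and> a' aDel w = 0. of_bool (v = w) * \<alpha> + of_bool ({w, v} \<in> E))"
        if "v \<in> H" "v \<noteq> r' rU" for v
        using count_value[where a = a', OF lt(1) that(2) alive[symmetric] that(1)] by simp
      show ?thesis
        apply (rule ht_Seq[where ?N2.0 = 0 and ?N1.0 = ?D])
         apply (rule ht_Cond)
          apply (rule ht_Seq[where ?N1.0 = n and ?N2.0 = "4 * m + n"])
           apply (rule ht_fill[where g = "\<lambda>_. 0"])
               apply simp
              apply (simp add: reg)
             apply simp
            apply simp
           apply (rule ht_Seq[where ?N1.0 = "4 * m" and ?N2.0 = n])
            apply (rule ht_count_paths[where u = "r' rU"])
               apply simp
              apply (rule lt)
             apply simp
            apply (rule ht_scan_counts)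
                apply (simp add: reg)
               apply (simp add: I)
              apply simp
        subgoal premises p for f r1 r2
        proof -
          have "pair_ok \<alpha> \<tau> E H (r' rU) v" if v: "v \<in> H" "v \<noteq> r' rU" for v
          proof -
            have "v < n" using v Hn by auto
            then show ?thesis unfolding pair_ok_def cnt[OF v]
              using p(6)[of v] p(2-4) v alive reg by auto
          qed
          moreover from this have "card H \<le> 2 * m + 1"
            using card_alive_le[OF Hn(1) True lt(2)] by blast
          ultimately show ?thesis using I p True step[OF True]
            by (intro ht_set) (auto simp: less_Suc_eq)
        qed
        subgoal premises p for f r1 r2
        proof -
          have v: "r2 rSnd \<in> H" "r2 rSnd \<noteq> r' rU" using p alive by auto
          then have "r2 rSnd < n" using Hn by auto
          then have "\<not> pair_ok \<alpha> \<tau> E H (r' rU) (r2 rSnd)" unfolding pair_ok_def cnt[OF v]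
            using p alive reg by auto
          then show ?thesis using I p True stop[OF True] v
            by (intro ht_set) auto
        qed
        using True alive I stop[OF True] by (auto intro!: ht_intros)
    qed
  next
    case (4 r' a')
    then have I: "agree {rFound..rV} r r'" "agree {aCount} a a'"
      "r' rFound = 0 \<and> (\<forall>u < r' rU. ?ok u) \<or> ?bad r'" by auto
    show ?case
    proof (cases "r' rFound = 0")
      case True
      then have "n \<le> r' rU \<or> \<tau> = 0" using 4 r I by auto
      then have "pair_ok \<alpha> \<tau> E H u v" if "u \<in> H" "v \<in> H" "u \<noteq> v" for u v
      proof (cases "\<tau> = 0")
        case False
        then have "u < r' rU" using \<open>n \<le> r' rU \<or> \<tau> = 0\<close> that Hn by auto
        then show ?thesis using I(3) True that by simp
      qed (simp add: pair_ok_def)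
      then show ?thesis using Q0 I True by blast
    next
      case False
      then show ?thesis using Q1 I by simp
    qed
  qed
qed

end

section \<open>Finding a pair with few disjoint paths\<close>

text \<open>
  Breadth-first search over outgoing copies. From now on \<open>aCount\<close> marks the vertices reached;
  \<open>aOwned x\<close> is the incoming copy through which \<open>x\<close> was reached, and \<open>aParent x\<close> the outgoing copy
  before it.
\<close>

definition visit :: com where
  "visit = guarded (Conj (active rY) (Neg (Equal (V rY) (V rU))))
     (Cond (Equal (V rY) (V rV)) (rHit :=: Const 1)
       (rZ :=: A aOwner (V rY) ;;
        guarded (Equal (A aCount (V rZ)) (Const 0))
          (put aCount (V rZ) (Const 1) ;; put aOwned (V rZ) (V rY) ;;
           put aParent (V rZ) (V rX) ;; put aQueue (V rTail) (V rZ) ;; incr rTail)))"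

text \<open>The vertex itself is visited like a neighbour, because an outgoing copy may be matched
  to the incoming copy of the same vertex: that is the case \<open>f y = y\<close>.\<close>

definition visit_nbrs :: com where
  "visit_nbrs = rY :=: V rX ;; visit ;; rE :=: adj_start rX ;;
     While (Less (V rE) (adj_end rX)) (rY :=: Mem (V rE) ;; visit ;; incr rE)"

definition search :: com where
  "search = fill aCount (Const 0) ;; put aCount (V rU) (Const 1) ;;
     put aQueue (Const 0) (V rU) ;; rHead :=: Const 0 ;; rTail :=: Const 1 ;; rHit :=: Const 0 ;;
     While (Conj (eqc rHit 0) (Less (V rHead) (V rTail)))
       (rX :=: A aQueue (V rHead) ;; incr rHead ;; visit_nbrs)"

text \<open>Every incoming copy on the way back to \<open>s\<close> passes from its owner to the
  predecessor of that owner. In the end \<open>s\<close> owns one vertex more, and the last outgoing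
  copy is free for \<open>v\<close>; the set \<open>F\<close> is never stored.\<close>

definition augment :: com where
  "augment = While (Neg (Equal (V rX) (V rU)))
     (rY :=: A aOwned (V rX) ;; rX :=: A aParent (V rX) ;; put aOwner (V rY) (V rX))"

text \<open>\<open>rZ\<close> is the loop counter of \<open>fill\<close>, so the owner map starts as
  the identity, the empty system of paths.\<close>

definition check_pair_flow :: com where
  "check_pair_flow = fill aOwner (V rZ) ;; rJ :=: Const 0 ;;
     While (Conj (eqc rFound 0) (Less (V rJ) (V rConn)))
       (search ;;
        Cond (eqc rHit 1) (augment ;; incr rJ)
          (rFound :=: Const 1 ;; rFst :=: V rU ;; rSnd :=: V rV))"

definition check_source :: com where
  "check_source = rV :=: Const 0 ;;
     While (Conj (eqc rFound 0) (Less (V rV) (V rN)))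
       (guarded (Conj (active rV) (Neg (Equal (V rV) (V rU)))) check_pair_flow ;; incr rV)"

definition check_flows :: com where
  "check_flows = rSources :=: Const 0 ;; rU :=: Const 0 ;;
     While (Conj (eqc rFound 0) (Conj (Less (V rU) (V rN)) (Less (V rSources) (V rConn))))
       (guarded (active rU) (incr rSources ;; check_source) ;; incr rU)"

lemma linkage_cong:
  assumes "image_mset f (mset_set (H - {s, v})) = image_mset g (mset_set (H - {s, v}))"
  shows "linkage E H s v j f \<longleftrightarrow> linkage E H s v j g"
  unfolding linkage_def assms ..

context graph_input
begin

text \<open>Parents stand strictly earlier in the queue. Hence the way back ends at
  \<open>s\<close>, which has position 0, and the position serves as the measure for
  \<open>augment\<close>.\<close>

definition search_state ::
    "nat set \<Rightarrow> nat \<Rightarrow> nat \<Rightarrow> (nat \<Rightarrow> nat) \<Rightarrow> regs \<Rightarrow> arrays \<Rightarrow> bool" where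
  "search_state H s v f r a \<longleftrightarrow>
     r rU = s \<and> r rV = v \<and> alive a = H \<and> a aOwner = f \<and> s \<in> H \<and>
     0 < r rTail \<and> a aQueue 0 = s \<and> inj_on (a aQueue) {..<r rTail} \<and>
     a aQueue ` {..<r rTail} = {x \<in> H. a aCount x \<noteq> 0} \<and> a aCount v = 0 \<and>
     (\<forall>i. 0 < i \<and> i < r rTail \<longrightarrow> (let x = a aQueue i; y = a aOwned x in
        y \<in> H - {s, v} \<and> f y = x \<and>
        (\<exists>k<i. a aParent x = a aQueue k \<and> (y = a aQueue k \<or> {a aQueue k, y} \<in> E)))) \<and>
     (r rHit = 0 \<or> r rHit = 1 \<and> r rX \<in> a aQueue ` {..<r rTail} \<and> {r rX, v} \<in> E)"

definition search_extends :: "regs \<Rightarrow> arrays \<Rightarrow> regs \<Rightarrow> arrays \<Rightarrow> bool" where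
  "search_extends r a r' a' \<longleftrightarrow>
     agree {rE, rZ, rY, rTail, rHit} r r' \<and> agree {aCount, aOwned, aParent, aQueue} a a' \<and>
     r rTail \<le> r' rTail \<and> (\<forall>k<r rTail. a' aQueue k = a aQueue k) \<and>
     (\<forall>x. a aCount x \<noteq> 0 \<longrightarrow> a' aCount x \<noteq> 0) \<and> (r rHit = 1 \<longrightarrow> r' rHit = 1)"

abbreviation reached :: "nat set \<Rightarrow> nat \<Rightarrow> nat \<Rightarrow> (nat \<Rightarrow> nat) \<Rightarrow> arrays \<Rightarrow> nat \<Rightarrow> bool" where
  "reached H s v f a y \<equiv> y \<in> H \<and> y \<noteq> s \<longrightarrow> y \<noteq> v \<and> a aCount (f y) \<noteq> 0"

lemma search_extends_trans:
  "search_extends r a r' a' \<Longrightarrow> search_extends r' a' r'' a'' \<Longrightarrow> search_extends r a r'' a''"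
  unfolding search_extends_def by auto

lemma search_state_cong:
  "search_state H s v f r a \<Longrightarrow> agree {rE, rZ, rY, rHead} r r' \<Longrightarrow> search_state H s v f r' a"
proof -
  assume S: "search_state H s v f r a" and "agree {rE, rZ, rY, rHead} r r'"
  then have eqs: "r' rU = r rU" "r' rV = r rV" "r' rTail = r rTail" "r' rHit = r rHit" "r' rX = r rX"
    by simp_all
  show ?thesis using S unfolding search_state_def eqs .
qed

lemma ht_visit:
  assumes S: "search_state H s v f r a" and own: "owner_map E H s v f"
    and x: "r rX \<in> a aQueue ` {..<r rTail}" and y: "r rY = r rX \<or> {r rX, r rY} \<in> E"
    and Q: "\<And>r' a'. search_state H s v f r' a' \<Longrightarrow> search_extends r a r' a' \<Longrightarrow> r' rE = r rE \<Longrightarrow>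
      r' rY = r rY \<Longrightarrow> r' rHit = 1 \<or> reached H s v f a' (r rY) \<Longrightarrow> Q r' a'"
  shows "ht visit r a N Q"
proof -
  have xH: "r rX \<in> H" "r rX \<noteq> v" and reg: "r rU = s" "r rV = v" "alive a = H" "a aOwner = f"
    using S x by (auto simp: search_state_def)
  have yn: "r rY < n" using y xH(1) reg(3) edgeD by auto
  then have yH: "r rY \<in> H \<longleftrightarrow> a aDel (r rY) = 0" using reg(3) by auto
  have ext0: "search_extends r a r a" by (auto simp: search_extends_def)
  show ?thesis unfolding visit_def
  proof (rule ht_Cond, goal_cases)
    case 1
    then have yy: "r rY \<in> H" "r rY \<noteq> s" using yH reg by auto
    show ?case
    proof (rule ht_Cond, goal_cases)
      case 1
      then have "r rY = v" using reg by simp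
      then have "{r rX, v} \<in> E" using y xH(2) by auto
      with x show ?case using S
        by (intro ht_set Q) (auto simp: search_state_def search_extends_def)
    next
      case 2
      then have yv: "r rY \<noteq> v" using reg by simp
      let ?z = "f (r rY)"
      have z: "?z \<in> H" "?z \<noteq> v" using own yy yv by (auto simp: owner_map_def)
      show ?case
      proof (rule ht_Seq0, rule ht_set, rule ht_Cond, goal_cases)
        case 1
        then have new: "a aCount ?z = 0" using reg by simp
        let ?r = "r(rZ := ?z, rTail := r rTail + 1)"
        let ?a = "a(aCount := (a aCount)(?z := 1), aOwned := (a aOwned)(?z := r rY),
          aParent := (a aParent)(?z := r rX), aQueue := (a aQueue)(r rTail := ?z))"
        from x obtain k where k: "k < r rTail" "r rX = a aQueue k" by auto
        have sN: "?z \<notin> a aQueue ` {..<r rTail}" using S new by (auto simp: search_state_def)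
        \<comment> \<open>The new entry differs from all old ones, so the pointers written at
          \<open>?z\<close> leave theirs intact.\<close>
        have neq: "a aQueue i \<noteq> ?z" if "i < r rTail" for i using sN that by (metis imageI lessThan_iff)
        have img: "?a aQueue ` {..<Suc (r rTail)} = insert ?z (a aQueue ` {..<r rTail})"
          by (auto simp: lessThan_Suc)
        have "search_state H s v f ?r ?a"
          unfolding search_state_def
        proof (intro conjI, goal_cases)
          case 8
          have "inj_on (?a aQueue) {..<r rTail} \<longleftrightarrow> inj_on (a aQueue) {..<r rTail}"
            by (intro inj_on_cong) auto
          then show ?case using S sN by (auto simp: search_state_def lessThan_Suc)
        next
          case 9
          then show ?case using S z img by (auto simp: search_state_def)
        next
          case 11
          show ?case
          proof (intro allI impI)
            fix i assume i: "0 < i \<and> i < ?r rTail"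
            show "let x = ?a aQueue i; y = ?a aOwned x in
              y \<in> H - {s, v} \<and> f y = x \<and> (\<exists>k<i. ?a aParent x = ?a aQueue k \<and>
                (y = ?a aQueue k \<or> {?a aQueue k, y} \<in> E))"
            proof (cases "i = r rTail")
              case True
              then show ?thesis using yy yv y k by (auto simp: Let_def intro!: exI[of _ k])
            next
              case False
              then have lt: "i < r rTail" using i by simp
              then have "let x = a aQueue i; y = a aOwned x in
                y \<in> H - {s, v} \<and> f y = x \<and> (\<exists>k<i. a aParent x = a aQueue k \<and>
                  (y = a aQueue k \<or> {a aQueue k, y} \<in> E))"
                using S i unfolding search_state_def by blast
              then obtain k' where "k' < i" "a aParent (a aQueue i) = a aQueue k'"
                "a aOwned (a aQueue i) = a aQueue k' \<or> {a aQueue k', a aOwned (a aQueue i)} \<in> E"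
                "a aOwned (a aQueue i) \<in> H - {s, v}" "f (a aOwned (a aQueue i)) = a aQueue i"
                by (auto simp: Let_def)
              then show ?thesis using neq[OF lt] lt by (auto simp: Let_def intro!: exI[of _ k'])
            qed
          qed
        next
          case 12
          then show ?case using S by (auto simp: search_state_def img)
        qed (use S reg z in \<open>auto simp: search_state_def\<close>)
        moreover have "search_extends r a ?r ?a" by (auto simp: search_extends_def)
        ultimately have "Q ?r ?a" using yv by (intro Q) auto
        then show ?case using reg by (intro ht_intros) (simp_all add: fun_upd_twist)
      next
        case 2
        then show ?case using S reg yv
          by (intro ht_Skip Q) (auto simp: search_extends_def elim!: search_state_cong)
      qed
    qed
  next
    case 2
    then show ?case using S ext0 yH reg by (intro ht_Skip Q) auto
  qed
qed


lemma ht_visit_nbrs: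
  assumes S: "search_state H s v f r a" and own: "owner_map E H s v f"
    and x: "r rX = x" "x \<in> a aQueue ` {..<r rTail}" and N: "deg x \<le> N"
    and Q: "\<And>r' a'. search_state H s v f r' a' \<Longrightarrow> search_extends r a r' a' \<Longrightarrow>
      r' rHit = 1 \<or> (\<forall>y. y = x \<or> {x, y} \<in> E \<longrightarrow> reached H s v f a' y) \<Longrightarrow> Q r' a'"
  shows "ht visit_nbrs r a N Q"
proof -
  have xn: "x < n" using S x by (auto simp: search_state_def)
  have addrs: "3 + x < B" "4 + x < B" using addr xn by auto
  let ?I = "\<lambda>r' a'. search_state H s v f r' a' \<and> search_extends r a r' a' \<and>
    inp (3 + x) \<le> r' rE \<and> r' rE \<le> inp (4 + x) \<and>
    (r' rHit = 1 \<or> (\<forall>y. y = x \<or> y \<in> inp ` {inp (3 + x)..<r' rE} \<longrightarrow> reached H s v f a' y))"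
  have xq: "r' rX = x" "x \<in> a' aQueue ` {..<r' rTail}" if "search_extends r a r' a'" for r' a'
  proof -
    show "r' rX = x" using that x by (simp add: search_extends_def)
    obtain k where "k < r rTail" "x = a aQueue k" using x by auto
    then show "x \<in> a' aQueue ` {..<r' rTail}" using that
      by (intro image_eqI[of _ _ k]) (auto simp: search_extends_def)
  qed
  show ?thesis
    unfolding visit_nbrs_def
  proof (intro ht_Seq0 ht_set, rule ht_visit[OF _ own], goal_cases)
    case 1
    show ?case using S by (rule search_state_cong) simp
  next
    case (4 r1 a1)
    have ext1: "search_extends r a r1 a1"
      by (rule search_extends_trans[OF _ 4(2)]) (simp add: search_extends_def)
    show ?case
    proof (intro ht_Seq0 ht_set, rule ht_While[where M = "\<lambda>_ _. 0"
          and \<Phi> = "\<lambda>r a. inp (4 + x) - r rE" and I = ?I], goal_cases)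
      case 1
      have "search_state H s v f (r1(rE := inp (3 + x))) a1"
        using 4(1) by (rule search_state_cong) simp
      moreover have "search_extends r a (r1(rE := inp (3 + x))) a1"
        by (rule search_extends_trans[OF ext1]) (simp add: search_extends_def)
      ultimately show ?case using 4(5) xq[OF ext1] range[OF xn] addrs x by simp
    next
      case 2
      then show ?case using N xq[OF ext1] addrs by simp
    next
      case (3 r2 a2)
      then have I: "?I r2 a2" by simp
      note xq2 = xq[of r2 a2]
      have lt: "r2 rE < inp (4 + x)" using 3 xq2 addrs by simp
      note nb = nbr_inp[OF xn _ lt]
      have ins: "{inp (3 + x)..<Suc (r2 rE)} = insert (r2 rE) {inp (3 + x)..<r2 rE}" using I by auto
      show ?case
      proof (intro ht_Seq0 ht_set, rule ht_visit[OF _ own], goal_cases)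
        case 1
        show ?case by (rule search_state_cong[of H s v f r2]) (use I in simp_all)
      next
        case 2
        then show ?case using xq2 I by simp
      next
        case 3
        then show ?case using xq2 I nb by simp
      next
        case (4 r3 a3)
        have ext: "search_extends r2 a2 (r3(rE := r3 rE + 1)) a3"
          using 4(2) by (simp add: search_extends_def)
        have "search_state H s v f (r3(rE := r3 rE + 1)) a3"
          using 4(1) by (rule search_state_cong) simp
        moreover have "search_extends r a (r3(rE := r3 rE + 1)) a3"
          using search_extends_trans[OF _ ext] I by blast
        moreover have "r3 rHit = 1 \<or>
            (\<forall>y. y = x \<or> y \<in> inp ` {inp (3 + x)..<Suc (r3 rE)} \<longrightarrow> reached H s v f a3 y)"
        proof (cases "r3 rHit = 1")
          case False
          \<comment> \<open>A hit is never withdrawn, so there was none before; marks are never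
            removed either, so what was reached stays reached.\<close>
          then have "r2 rHit \<noteq> 1" using 4(2) by (auto simp: search_extends_def)
          then have "\<forall>y. y = x \<or> y \<in> inp ` {inp (3 + x)..<r2 rE} \<longrightarrow> reached H s v f a3 y"
            using I ext unfolding search_extends_def by blast
          moreover have "reached H s v f a3 (inp (r2 rE))" using 4(5) False I nb by simp
          ultimately show ?thesis using 4(3) I ins by auto
        qed simp
        ultimately show ?case using 4(3) I lt by (intro ht_set) simp
      qed
    next
      case (4 r2 a2)
      then have I: "?I r2 a2" by simp
      note xq2 = xq[of r2 a2]
      have "r2 rE = inp (4 + x)" using 4 I xq2 addrs by simp
      then show ?case using I nbrs[OF xn] by (intro Q) auto
    qed
  qed (use x in auto)
qed

lemma ht_search:
  assumes r: "r rN = n" "r rU = s" "r rV = v" "alive a = H" "a aOwner = f"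
    and sv: "s \<in> H" "v \<in> H" "s \<noteq> v" and own: "owner_map E H s v f" and N: "2 * n + 2 * m \<le> N"
    and Q: "\<And>r' a'. agree ({rE, rZ} \<union> {rX..rHit}) r r' \<Longrightarrow>
      agree {aCount, aOwned, aParent, aQueue} a a' \<Longrightarrow> search_state H s v f r' a' \<Longrightarrow>
      (r' rHit = 0 \<Longrightarrow> \<forall>x \<in> a' aQueue ` {..<r' rTail}. \<forall>y. y = x \<or> {x, y} \<in> E \<longrightarrow>
         y \<in> H \<and> y \<noteq> s \<longrightarrow> y \<noteq> v \<and> f y \<in> a' aQueue ` {..<r' rTail}) \<Longrightarrow> Q r' a'"
  shows "ht search r a N Q"
proof -
  \<comment> \<open>Every vertex enters the queue at most once and pays \<open>deg x + 1\<close>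
    when it leaves; initially this amounts to at most \<open>n + 2 * m\<close>.\<close>
  let ?rest = "\<lambda>r a. \<Sum>x\<in>{..<n} - a aQueue ` {..<r rHead}. deg x + 1"
  let ?\<Phi> = "\<lambda>r a. if r rHit = (0::nat) then ?rest r a else 0"
  let ?I = "\<lambda>r' a'. search_state H s v f r' a' \<and> agree ({rE, rZ} \<union> {rX..rHit}) r r' \<and>
     agree {aCount, aOwned, aParent, aQueue} a a' \<and> r' rHead \<le> r' rTail \<and>
     (r' rHit = 0 \<longrightarrow> (\<forall>k<r' rHead. \<forall>y. y = a' aQueue k \<or> {a' aQueue k, y} \<in> E \<longrightarrow>
        reached H s v f a' y))"
  have sn: "s < n" using r sv by auto
  show ?thesis
    unfolding search_def
  proof (rule ht_Seq[where ?N1.0 = n and ?N2.0 = "n + 2 * m"], rule ht_fill[where g = "\<lambda>_. 0"], goal_cases)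
    case (5 g)
    show ?case
    proof (intro ht_Seq0 ht_set ht_put, rule ht_While[where M = "\<lambda>r a. deg (a aQueue (r rHead))"
          and \<Phi> = ?\<Phi> and I = ?I], goal_cases)
      case 1
      show ?case using r sv 5 sn
        by (auto simp: search_state_def lessThan_Suc)
    next
      case 2
      show ?case using degs by (simp add: sum_Suc)
    next
      case (3 r1 a1)
      then have I: "?I r1 a1" and hit: "r1 rHit = 0" and lt: "r1 rHead < r1 rTail" by auto
      let ?x = "a1 aQueue (r1 rHead)"
      have xH: "?x \<in> H" using I lt by (auto simp: search_state_def)
      then have xn: "?x < n" using r(4) by auto
      have inj: "inj_on (a1 aQueue) {..<r1 rTail}" using I by (auto simp: search_state_def)
      have xnew: "?x \<notin> a1 aQueue ` {..<r1 rHead}"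
        using inj_onD[OF inj] lt by fastforce
      have rest: "?rest r1 a1 = deg ?x + 1 + (\<Sum>x\<in>{..<n} - a1 aQueue ` {..<Suc (r1 rHead)}. deg x + 1)"
      proof -
        have eq: "{..<n} - a1 aQueue ` {..<r1 rHead} =
            insert ?x ({..<n} - a1 aQueue ` {..<Suc (r1 rHead)})"
          using xn xnew by (auto simp: lessThan_Suc)
        have "?x \<notin> {..<n} - a1 aQueue ` {..<Suc (r1 rHead)}" by simp
        then show ?thesis unfolding eq by (subst sum.insert) auto
      qed
      show ?case
      proof (intro ht_Seq0 ht_set, rule ht_visit_nbrs[OF _ own, where x = ?x], goal_cases)
        case 1
        have "search_state H s v f (r1(rX := ?x)) a1"
          using I hit r(4) by (simp add: search_state_def)
        then show ?case by (rule search_state_cong) simp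
      next
        case (5 r2 a2)
        then have ext: "r2 rTail \<ge> r1 rTail" "\<forall>k<r1 rTail. a2 aQueue k = a1 aQueue k"
          "\<forall>x. a1 aCount x \<noteq> 0 \<longrightarrow> a2 aCount x \<noteq> 0" "r2 rHead = Suc (r1 rHead)"
          by (simp_all add: search_extends_def)
        have img: "a2 aQueue ` {..<r2 rHead} = a1 aQueue ` {..<Suc (r1 rHead)}"
          using ext lt by auto
        note agr = I[THEN conjunct2, THEN conjunct1] I[THEN conjunct2, THEN conjunct2, THEN conjunct1]
        note S2 = 5(1) and E2 = 5(2) and reach2 = 5(3)
        have "r2 z = r z" if "z \<notin> {rE, rZ} \<union> {rX..rHit}" for z
        proof -
          have "z \<noteq> rHead" "z \<noteq> rX" "z \<notin> {rE, rZ, rY, rTail, rHit}" using that by auto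
          then have "r2 z = r1 z" using E2 unfolding search_extends_def by simp
          also have "\<dots> = r z" using agr(1) that by blast
          finally show ?thesis .
        qed
        moreover have "a2 z = a z" if "z \<notin> {aCount, aOwned, aParent, aQueue}" for z
        proof -
          have "a2 z = a1 z" using E2 that unfolding search_extends_def by simp
          also have "\<dots> = a z" using agr(2) that by blast
          finally show ?thesis .
        qed
        moreover have "reached H s v f a2 y"
          if "r2 rHit = 0" "k < r2 rHead" "y = a2 aQueue k \<or> {a2 aQueue k, y} \<in> E" for k y
        proof (cases "k = r1 rHead")
          case True
          then have "y = ?x \<or> {?x, y} \<in> E" using that(3) lt ext(2) by simp
          then show ?thesis using reach2 that(1) by (metis zero_neq_one)
        next
          case False
          then have "k < r1 rHead" "a2 aQueue k = a1 aQueue k" using that(2) lt ext by simp_all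
          then have "reached H s v f a1 y" using I hit that(3) by metis
          then show ?thesis using ext(3) by blast
        qed
        moreover have "r2 rHead \<le> r2 rTail" using ext lt by simp
        ultimately have "?I r2 a2" using S2 by blast
        then show ?case using rest img hit by simp
      qed (use lt in auto)
    next
      case (4 r1 a1)
      then have I: "?I r1 a1" by simp
      have "\<forall>x \<in> a1 aQueue ` {..<r1 rTail}. \<forall>y. y = x \<or> {x, y} \<in> E \<longrightarrow>
         y \<in> H \<and> y \<noteq> s \<longrightarrow> y \<noteq> v \<and> f y \<in> a1 aQueue ` {..<r1 rTail}" if hit: "r1 rHit = 0"
      proof -
        have "r1 rHead = r1 rTail" using 4 I hit by auto
        then have "\<forall>x \<in> a1 aQueue ` {..<r1 rTail}. \<forall>y. y = x \<or> {x, y} \<in> E \<longrightarrow> reached H s v f a1 y"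
          using I hit by auto
        moreover have "z \<in> a1 aQueue ` {..<r1 rTail}" if "z \<in> H" "a1 aCount z \<noteq> 0" for z
          using I that by (auto simp: search_state_def)
        moreover have "f y \<in> H" if "y \<in> H" "y \<noteq> s" "y \<noteq> v" for y
          using own that by (auto simp: owner_map_def)
        ultimately show ?thesis by blast
      qed
      then show ?case using I by (intro Q) auto
    qed simp_all
  qed (use r N in auto)
qed


lemma search_state_length:
  assumes "search_state H s v f r a"
  shows "r rTail \<le> n"
proof -
  have "a aQueue ` {..<r rTail} \<subseteq> {..<n}" "inj_on (a aQueue) {..<r rTail}"
    using assms by (auto simp: search_state_def)
  then show ?thesis using card_inj_on_le[of "a aQueue" "{..<r rTail}" "{..<n}"] by simp
qed

text \<open>Halfway through, some outgoing copy is owner of two incoming copies, so the current map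
  is no linkage. The invariant instead describes the map after \<open>s\<close> has provisionally
  taken over \<open>own (q i)\<close>: that one is a linkage with \<open>j + 1\<close> paths.
  \<open>linkage_extend\<close> establishes this at the hit, \<open>image_mset_swap\<close> carries
  it to the parent, and at position 0 the provision is the actual map because
  \<open>q 0 = s\<close>.\<close>

lemma ht_augment:
  assumes S: "search_state H s v f r a" and own: "owner_map E H s v f"
    and lnk: "{s, v} \<in> E \<or> linkage E H s v j f" and hit: "r rHit = 1" and N: "n \<le> N"
    and Q: "\<And>r' a'. agree {rX, rY} r r' \<Longrightarrow> agree {aOwner} a a' \<Longrightarrow>
      owner_map E H s v (a' aOwner) \<Longrightarrow> {s, v} \<in> E \<or> linkage E H s v (Suc j) (a' aOwner) \<Longrightarrow> Q r' a'"
  shows "ht augment r a N Q"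
proof -
  define q own par t where "q = a aQueue" and "own = a aOwned" and "par = a aParent" and "t = r rTail"
  note defs = q_def own_def par_def t_def
  have inj: "inj_on q {..<t}" and fin: "finite H" and q0: "q 0 = s" "0 < t" and s: "r rU = s" "a aOwner = f"
    using S by (auto simp: search_state_def defs)
  have qH: "q k \<in> H" "q k \<noteq> v" if "k < t" for k
  proof -
    have "q k \<in> {x \<in> H. a aCount x \<noteq> 0}" "a aCount v = 0"
      using S that by (auto simp: search_state_def defs)
    then show "q k \<in> H" "q k \<noteq> v" by auto
  qed
  have tree: "own (q k) \<in> H - {s, v} \<and> f (own (q k)) = q k \<and> (\<exists>k'<k. par (q k) = q k' \<and>
      (own (q k) = q k' \<or> {q k', own (q k)} \<in> E))" if "0 < k" "k < t" for k
    using S that unfolding search_state_def defs Let_def by auto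
  have "r rHit = 0 \<or> r rHit = 1 \<and> r rX \<in> q ` {..<t} \<and> {r rX, v} \<in> E"
    using S unfolding search_state_def defs by blast
  then have hitX: "r rX \<in> q ` {..<t} \<and> {r rX, v} \<in> E" using hit by simp
  have qs: "q k = s \<longleftrightarrow> k = 0" if "k < t" for k
    using inj_onD[OF inj, of k 0] q0 that by auto
  let ?pos = "the_inv_into {..<t} q"
  have pos: "?pos (q k) = k" if "k < t" for k
    using the_inv_into_f_f[OF inj] that by simp
  let ?I = "\<lambda>r' a'. agree {rX, rY} r r' \<and> agree {aOwner} a a' \<and> owner_map E H s v (a' aOwner) \<and>
    (\<exists>i<t. r' rX = q i \<and> (\<forall>k. 0 < k \<and> k \<le> i \<longrightarrow> a' aOwner (own (q k)) = q k) \<and>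
      ({s, v} \<in> E \<or> linkage E H s v (Suc j)
        (if i = 0 then a' aOwner else (a' aOwner)(own (q i) := s))))"
  show ?thesis
    unfolding augment_def
  proof (rule ht_While[where M = "\<lambda>_ _. 0" and \<Phi> = "\<lambda>r a. ?pos (r rX)" and I = ?I], goal_cases)
    case 1
    from hitX obtain i where i: "i < t" "r rX = q i" "{q i, v} \<in> E" by auto
    \<comment> \<open>A hit at position 0 means that \<open>s\<close> itself is adjacent to
      \<open>v\<close>, which is the first alternative.\<close>
    have "{s, v} \<in> E \<or> linkage E H s v (Suc j) (if i = 0 then f else f(own (q i) := s))"
    proof (cases "i = 0")
      case False
      then have "own (q i) \<in> H - {s, v}" "f (own (q i)) = q i" "q i \<noteq> s"
        using tree[of i] i qs by auto
      then show ?thesis using lnk linkage_extend[of E H s v j f "own (q i)"] fin i False by auto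
    qed (use i q0 in simp)
    moreover have "\<forall>k. 0 < k \<and> k \<le> i \<longrightarrow> f (own (q k)) = q k" using tree i(1) by simp
    ultimately show ?case using i s \<open>owner_map E H s v f\<close> by blast
  next
    case 2
    from hitX obtain i where "i < t" "r rX = q i" by auto
    then show ?case using pos[of i] search_state_length[OF S] N t_def by simp
  next
    case (3 r1 a1)
    then obtain i where I: "agree {rX, rY} r r1" "agree {aOwner} a a1" "owner_map E H s v (a1 aOwner)"
      and i: "i < t" "r1 rX = q i" "\<forall>k. 0 < k \<and> k \<le> i \<longrightarrow> a1 aOwner (own (q k)) = q k"
      and l: "{s, v} \<in> E \<or> linkage E H s v (Suc j)
        (if i = 0 then a1 aOwner else (a1 aOwner)(own (q i) := s))" by blast
    have "q i \<noteq> s" using 3(2) i I s by simp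
    then have i0: "0 < i" using qs i by auto
    let ?y = "own (q i)" and ?g = "a1 aOwner"
    obtain k where k: "k < i" "par (q i) = q k" "?y = q k \<or> {q k, ?y} \<in> E"
      and y: "?y \<in> H - {s, v}" using tree[OF i0 i(1)] by blast
    have kt: "k < t" using k i by simp
    have gy: "?g ?y = q i" using i i0 by simp
    \<comment> \<open>The current map sends \<open>own (q k')\<close> to \<open>q k'\<close> for all
      positions up to \<open>i\<close>, and the queue is injective; so reassigning \<open>?y\<close>
      does not disturb the earlier positions.\<close>
    have neq: "own (q k') \<noteq> ?y" if "0 < k'" "k' \<le> k" for k'
    proof
      assume "own (q k') = ?y"
      moreover have "?g (own (q k')) = q k'" using i(3) that k(1) by simp
      ultimately have "q k' = q i" using gy by metis
      moreover have "k' \<in> {..<t}" "i \<in> {..<t}" "k' \<noteq> i" using that k(1) i(1) by auto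
      ultimately show False using inj_onD[OF inj] by blast
    qed
    have arr: "a1 aOwned = own" "a1 aParent = par" using I(2) by (simp_all add: defs)
    let ?g' = "?g(?y := q k)"
    have "owner_map E H s v ?g'" using I(3) k(3) y qH[OF kt] by (auto simp: owner_map_def)
    moreover have "\<forall>k'. 0 < k' \<and> k' \<le> k \<longrightarrow> ?g' (own (q k')) = q k'"
      using neq i(3) k by auto
    moreover have "{s, v} \<in> E \<or> linkage E H s v (Suc j) (if k = 0 then ?g' else ?g'(own (q k) := s))"
    proof (cases "k = 0")
      case True
      then show ?thesis using l i0 q0 by simp
    next
      case False
      then have "own (q k) \<in> H - {s, v}" "?g (own (q k)) = q k" "own (q k) \<noteq> ?y"
        using tree[of k] kt i(3) k neq[of k] by auto
      then have "linkage E H s v (Suc j) (?g'(own (q k) := s)) \<longleftrightarrow>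
          linkage E H s v (Suc j) (?g(?y := s))"
        using image_mset_swap[of "H - {s, v}" ?y "own (q k)" ?g s] fin y
        by (intro linkage_cong) auto
      then show ?thesis using l i0 False by simp
    qed
    moreover have "agree {rX, rY} r (r1(rY := ?y, rX := q k))" "agree {aOwner} a (a1(aOwner := ?g'))"
      using I by simp_all
    moreover have "(r1(rY := ?y, rX := q k)) rX = q k" "(a1(aOwner := ?g')) aOwner = ?g'" by simp_all
    ultimately have "?I (r1(rY := ?y, rX := q k)) (a1(aOwner := ?g'))"
      using kt by metis
    moreover have "ht (rY :=: A aOwned (V rX) ;; rX :=: A aParent (V rX) ;; put aOwner (V rY) (V rX)) r1 a1 0
        (\<lambda>r' a'. r' = r1(rY := ?y, rX := q k) \<and> a' = a1(aOwner := ?g'))"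
      using k(2) i(2) arr by (intro ht_intros) simp_all
    moreover have "0 + 1 + ?pos (q k) \<le> ?pos (q i)" using pos[OF kt] pos[OF i(1)] k(1) by simp
    ultimately show ?case unfolding i(2) by (elim ht_mono) auto
  next
    case (4 r1 a1)
    then obtain i where I: "agree {rX, rY} r r1" "agree {aOwner} a a1" "owner_map E H s v (a1 aOwner)"
      and i: "i < t" "r1 rX = q i"
      and l: "{s, v} \<in> E \<or> linkage E H s v (Suc j)
        (if i = 0 then a1 aOwner else (a1 aOwner)(own (q i) := s))" by blast
    have "i = 0" using 4(2) i I s qs by simp
    then show ?case using I l by (intro Q) auto
  qed
qed

text \<open>Branching has to rule out every solution inside \<open>H\<close>, hence the quantifier
  over subsets; acceptance, in \<open>inseparable\<close>, concerns \<open>H\<close> alone.\<close>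

definition separated :: "nat \<Rightarrow> nat set \<Rightarrow> nat \<Rightarrow> nat \<Rightarrow> bool" where
  "separated c H s v \<longleftrightarrow>
     s \<in> H \<and> v \<in> H \<and> s \<noteq> v \<and> (\<forall>S\<subseteq>H. robustly_connected c E S \<longrightarrow> \<not> (s \<in> S \<and> v \<in> S))"

definition inseparable :: "nat \<Rightarrow> nat set \<Rightarrow> nat \<Rightarrow> nat \<Rightarrow> bool" where
  "inseparable c H s v \<longleftrightarrow>
     (\<forall>U\<subseteq>H. card U < c \<longrightarrow> s \<notin> U \<longrightarrow> v \<notin> U \<longrightarrow> (s, v) \<in> (linked E (H - U))\<^sup>*)"

text \<open>Adjacent \<open>s\<close> and \<open>v\<close> cannot be separated by deleting other
  vertices, so the invariant then claims no linkage, and every search hits. A round costs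
  \<open>2 * n + 2 * m\<close> for the search, \<open>n\<close> for the augmentation and 1 for the
  loop.\<close>

lemma ht_check_pair_flow:
  assumes r: "r rN = n" "r rConn = c" "r rFound = 0" "alive a = H" "r rU = s" "r rV = v"
    and sv: "s \<in> H" "v \<in> H" "s \<noteq> v" and N: "n + c * (3 * n + 2 * m + 1) \<le> N"
    and Q: "\<And>r' a'. agree ({rFound, rFst, rSnd, rE, rZ} \<union> {rJ..rHit}) r r' \<Longrightarrow>
      agree {aCount..aQueue} a a' \<Longrightarrow>
      r' rFound = 0 \<and> inseparable c H s v \<or>
      r' rFound = 1 \<and> r' rFst = s \<and> r' rSnd = v \<and> separated c H s v \<Longrightarrow> Q r' a'"
  shows "ht check_pair_flow r a N Q"
proof -
  let ?D = "3 * n + 2 * m"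
  let ?\<Phi> = "\<lambda>r a. if r rFound = (0::nat) then (c - r rJ) * (?D + 1) else 0"
  let ?I = "\<lambda>r' a'. agree ({rFound, rFst, rSnd, rE, rZ} \<union> {rJ..rHit}) r r' \<and>
    agree {aCount..aQueue} a a' \<and>
    (r' rFound = 0 \<and> r' rJ \<le> c \<and> owner_map E H s v (a' aOwner) \<and>
      ({s, v} \<in> E \<or> linkage E H s v (r' rJ) (a' aOwner)) \<or>
     r' rFound = 1 \<and> r' rFst = s \<and> r' rSnd = v \<and> separated c H s v)"
  have fin: "finite H" using r by auto
  show ?thesis
    unfolding check_pair_flow_def
  proof (rule ht_Seq[OF _ N], rule ht_fill[where g = "\<lambda>i. i"], goal_cases)
    case (5 g)
    have gid: "g y = y" if "y \<in> H" for y using 5 that r by auto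
    have "image_mset g (mset_set (H - {s, v})) = image_mset (\<lambda>y. y) (mset_set (H - {s, v}))"
      using fin gid by (intro image_mset_cong) auto
    from linkage_cong[OF this] have lnk: "linkage E H s v 0 g" using linkage_id by metis
    have own: "owner_map E H s v g" using gid by (auto simp: owner_map_def)
    show ?case
    proof (intro ht_Seq0 ht_set, rule ht_While[where M = "\<lambda>_ _. ?D" and \<Phi> = ?\<Phi> and I = ?I], goal_cases)
      case 1
      show ?case using lnk own r by simp
    next
      case 2
      show ?case by simp
    next
      case (3 r1 a1)
      then have I: "agree ({rFound, rFst, rSnd, rE, rZ} \<union> {rJ..rHit}) r r1"
        "agree {aCount..aQueue} a a1" "owner_map E H s v (a1 aOwner)"
        "{s, v} \<in> E \<or> linkage E H s v (r1 rJ) (a1 aOwner)"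
        and f0: "r1 rFound = 0" and jc: "r1 rJ < c" using r by auto
      have "c - r1 rJ = Suc (c - Suc (r1 rJ))" using jc by simp
      then have \<Phi>1: "(c - r1 rJ) * (?D + 1) = ?D + 1 + (c - Suc (r1 rJ)) * (?D + 1)"
        by (simp only: mult_Suc)
      show ?case
      proof (rule ht_Seq[where ?N1.0 = "2 * n + 2 * m" and ?N2.0 = n],
          rule ht_search[where H = H and s = s and v = v and f = "a1 aOwner"], goal_cases)
        case (11 r2 a2)
        show ?case
        proof (rule ht_Cond, goal_cases)
          case 1
          show ?case
          proof (rule ht_Seq[where ?N1.0 = n and ?N2.0 = 0],
              rule ht_augment[OF 11(3) I(3) I(4)], goal_cases)
            case (3 r3 a3)
            have "?I (r3(rJ := r3 rJ + 1)) a3" using I f0 jc 11(1,2) 3 by auto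
            moreover have "r3 rJ = r1 rJ" "r3 rFound = 0" using 11(1) 3 f0 by simp_all
            ultimately show ?case using \<Phi>1 f0 by (intro ht_set) auto
          qed (use 1 in auto)
        next
          case 2
          then have "r2 rHit = 0" using 11(3) by (auto simp: search_state_def)
          note cl = 11(4)[OF this]
          let ?X = "a2 aQueue ` {..<r2 rTail}"
          have X: "?X \<subseteq> H" "s \<in> ?X" "v \<notin> ?X"
          proof -
            have "?X = {x \<in> H. a2 aCount x \<noteq> 0}" "a2 aCount v = 0" "0 < r2 rTail" "a2 aQueue 0 = s"
              using 11(3) by (auto simp: search_state_def)
            then show "?X \<subseteq> H" "v \<notin> ?X" "s \<in> ?X" by (auto intro: rev_image_eqI[of 0])
          qed
          \<comment> \<open>An exhausted search has inspected all neighbours of \<open>s\<close> and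
            would have met an adjacent \<open>v\<close>.\<close>
          have "{s, v} \<notin> E" using cl X(2) sv by blast
          then have lnk: "linkage E H s v (r1 rJ) (a1 aOwner)" using I(4) by blast
          have "separated c H s v"
            unfolding separated_def
          proof (intro conjI allI impI notI)
            fix S assume S: "S \<subseteq> H" "robustly_connected c E S" "s \<in> S \<and> v \<in> S"
            show False
              by (rule closed_imp_separated[OF fin X(1,2) sv(2) X(3) lnk jc _ S(1,2)])
                (use cl S in blast)+
          qed (use sv in auto)
          moreover have "r2 rU = s" "r2 rV = v" using 11(1) I(1) r by simp_all
          ultimately have "?I (r2(rFound := 1, rFst := s, rSnd := v)) a2"
            using I 11(1,2) by auto
          then show ?case using \<Phi>1 f0 \<open>r2 rU = s\<close> \<open>r2 rV = v\<close> by (intro ht_intros) auto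
        qed
      qed (use I r sv in auto)
    next
      case (4 r1 a1)
      then have I: "?I r1 a1" by simp
      have "inseparable c H s v" if f0: "r1 rFound = 0"
      proof -
        have "r1 rJ = c" using 4(2) I f0 r by auto
        then have lnk: "owner_map E H s v (a1 aOwner)" "{s, v} \<in> E \<or> linkage E H s v c (a1 aOwner)"
          using I f0 by auto
        show ?thesis
          unfolding inseparable_def
        proof (intro allI impI)
          fix U assume U: "U \<subseteq> H" "card U < c" "s \<notin> U" "v \<notin> U"
          show "(s, v) \<in> (linked E (H - U))\<^sup>*"
          proof (cases "{s, v} \<in> E")
            case True
            then have "(s, v) \<in> linked E (H - U)" using sv U by (simp add: linked_def)
            then show ?thesis by blast
          next
            case False
            then show ?thesis using linkage_imp_linked[OF fin sv False lnk(1) _ U] lnk(2) by blast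
          qed
        qed
      qed
      then show ?case using I by (intro Q) auto
    qed
  qed (use r in auto)
qed

end

section \<open>The combined check of one vertex set and its cost\<close>

definition check :: com where
  "check = rFound :=: Const 0 ;; check_pairs ;; check_flows"

context graph_input
begin

definition source_cost :: "nat \<Rightarrow> nat set \<Rightarrow> nat" where
  "source_cost c H = n + card H * (n + c * (3 * n + 2 * m + 1))"

lemma separated_imp:
  assumes "separated c H s v" "S \<subseteq> H" "good \<alpha> \<tau> c E S"
  shows "\<not> (s \<in> S \<and> v \<in> S)"
  using assms by (auto simp: separated_def good_def)

lemma ht_check_source:
  assumes r: "r rN = n" "r rConn = c" "r rFound = 0" "alive a = H" "r rU = s"
    and s: "s \<in> H" and N: "source_cost c H \<le> N"
    and Q: "\<And>r' a'. agree ({rFound, rFst, rSnd, rE, rZ, rV} \<union> {rJ..rHit}) r r' \<Longrightarrow>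
      agree {aCount..aQueue} a a' \<Longrightarrow>
      r' rFound = 0 \<and> (\<forall>v\<in>H. v \<noteq> s \<longrightarrow> inseparable c H s v) \<or>
      r' rFound = 1 \<and> separated c H (r' rFst) (r' rSnd) \<Longrightarrow> Q r' a'"
  shows "ht check_source r a N Q"
proof -
  let ?P = "n + c * (3 * n + 2 * m + 1)"
  let ?K = "\<lambda>i. card {w \<in> H. i \<le> w}"
  let ?\<Phi> = "\<lambda>r a. (n - r rV) + ?K (r rV) * ?P"
  let ?I = "\<lambda>r' a'. agree ({rFound, rFst, rSnd, rE, rZ, rV} \<union> {rJ..rHit}) r r' \<and>
    agree {aCount..aQueue} a a' \<and>
    (r' rFound = 0 \<and> (\<forall>v\<in>H. v < r' rV \<longrightarrow> v \<noteq> s \<longrightarrow> inseparable c H s v) \<or>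
     r' rFound = 1 \<and> separated c H (r' rFst) (r' rSnd))"
  have fin: "finite H" and Hn: "H \<subseteq> {..<n}" using r by auto
  have K: "?K i = of_bool (i \<in> H) + ?K (Suc i)" for i
  proof (cases "i \<in> H")
    case True
    then have "{w \<in> H. i \<le> w} = insert i {w \<in> H. Suc i \<le> w}" by auto
    then show ?thesis using True fin by simp
  next
    case False
    then have "{w \<in> H. i \<le> w} = {w \<in> H. Suc i \<le> w}" using le_eq_less_or_eq by auto
    then show ?thesis using False by simp
  qed
  show ?thesis
    unfolding check_source_def
  proof (intro ht_Seq0 ht_set, rule ht_While[where M = "\<lambda>r a. of_bool (r rV \<in> H) * ?P"
        and \<Phi> = ?\<Phi> and I = ?I], goal_cases)
    case 1
    show ?case using r by simp
  next
    case 2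
    show ?case using N by (simp add: source_cost_def)
  next
    case (3 r1 a1)
    then have I: "agree ({rFound, rFst, rSnd, rE, rZ, rV} \<union> {rJ..rHit}) r r1"
      "agree {aCount..aQueue} a a1" "\<forall>v\<in>H. v < r1 rV \<longrightarrow> v \<noteq> s \<longrightarrow> inseparable c H s v"
      and f0: "r1 rFound = 0" and lt: "r1 rV < n" using r by auto
    have reg: "r1 rN = n" "r1 rConn = c" "r1 rU = s" "alive a1 = H" using I(1,2) r by simp_all
    have del: "a1 aDel (r1 rV) = 0 \<longleftrightarrow> r1 rV \<in> H" using reg(4) lt by auto
    have \<Phi>1: "of_bool (r1 rV \<in> H) * ?P + 1 + ((n - Suc (r1 rV)) + ?K (Suc (r1 rV)) * ?P)
        \<le> (n - r1 rV) + ?K (r1 rV) * ?P"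
      unfolding K[of "r1 rV"] distrib_right using lt by simp
    show ?case
    proof (rule ht_Seq[where ?N2.0 = 0 and ?N1.0 = "of_bool (r1 rV \<in> H) * ?P"], rule ht_Cond, goal_cases)
      case 1
      then have v: "r1 rV \<in> H" "r1 rV \<noteq> s" using del reg by auto
      show ?case
      proof (rule ht_check_pair_flow[where r = r1 and a = a1, OF reg(1,2) f0 reg(4) reg(3) refl s v(1) v(2)[symmetric]], goal_cases)
        case 1
        then show ?case using v by simp
      next
        case (2 r2 a2)
        have rv: "r2 rV = r1 rV" using 2(1) by simp
        have "?I (r2(rV := Suc (r1 rV))) a2"
          using I 2 by (auto simp: less_Suc_eq)
        then show ?case using \<Phi>1 rv by (intro ht_set) simp
      qed
    next
      case 2
      then have v: "r1 rV \<notin> H \<or> r1 rV = s" using del reg by auto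
      then have "?I (r1(rV := Suc (r1 rV))) a1" using I f0 by (auto simp: less_Suc_eq)
      then show ?case using \<Phi>1 by (intro ht_Skip ht_set) simp
    qed simp
  next
    case (4 r1 a1)
    then have I: "?I r1 a1" by simp
    have "\<forall>v\<in>H. v \<noteq> s \<longrightarrow> inseparable c H s v" if "r1 rFound = 0"
    proof -
      have "n \<le> r1 rV" using 4 I that r by auto
      then show ?thesis using I that Hn by auto
    qed
    then show ?case using I by (intro Q) auto
  qed
qed

definition flows_cost :: "nat \<Rightarrow> nat set \<Rightarrow> nat" where
  "flows_cost c H = n + c * source_cost c H"

lemma ht_check_flows:
  assumes r: "r rN = n" "r rConn = c" "r rFound = 0" "alive a = H" and N: "flows_cost c H \<le> N"
    and Q: "\<And>r' a'. agree {rFound..rHit} r r' \<Longrightarrow> agree {aCount..aQueue} a a' \<Longrightarrow>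
      r' rFound = 0 \<and> robustly_connected c E H \<or>
      r' rFound = 1 \<and> separated c H (r' rFst) (r' rSnd) \<Longrightarrow> Q r' a'"
  shows "ht check_flows r a N Q"
proof -
  let ?C = "\<lambda>i. {w \<in> H. w < i}"
  let ?\<Phi> = "\<lambda>r a. (n - r rU) + (c - r rSources) * source_cost c H"
  let ?I = "\<lambda>r' a'. agree {rFound..rHit} r r' \<and> agree {aCount..aQueue} a a' \<and>
    r' rSources = card (?C (r' rU)) \<and>
    (r' rFound = 0 \<and> (\<forall>s\<in>?C (r' rU). \<forall>v\<in>H. v \<noteq> s \<longrightarrow> inseparable c H s v) \<or>
     r' rFound = 1 \<and> separated c H (r' rFst) (r' rSnd))"
  have fin: "finite H" and Hn: "H \<subseteq> {..<n}" using r by auto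
  have C: "?C (Suc i) = (if i \<in> H then insert i (?C i) else ?C i)" for i
    by (auto simp: less_Suc_eq)
  have cardC: "card (?C (Suc i)) = (if i \<in> H then Suc (card (?C i)) else card (?C i))" for i
    unfolding C using fin by simp
  show ?thesis
    unfolding check_flows_def
  proof (intro ht_Seq0 ht_set, rule ht_While[where M = "\<lambda>r a. if r rU \<in> H then source_cost c H else 0"
        and \<Phi> = ?\<Phi> and I = ?I], goal_cases)
    case 1
    show ?case using r by simp
  next
    case 2
    show ?case using N by (simp add: flows_cost_def)
  next
    case (3 r1 a1)
    then have I: "agree {rFound..rHit} r r1" "agree {aCount..aQueue} a a1"
      "r1 rSources = card (?C (r1 rU))"
      "\<forall>s\<in>?C (r1 rU). \<forall>v\<in>H. v \<noteq> s \<longrightarrow> inseparable c H s v"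
      and f0: "r1 rFound = 0" and lt: "r1 rU < n" and cc: "r1 rSources < c" using r by auto
    have reg: "r1 rN = n" "r1 rConn = c" "alive a1 = H" using I(1,2) r by simp_all
    have del: "a1 aDel (r1 rU) = 0 \<longleftrightarrow> r1 rU \<in> H" using reg(3) lt by auto
    have "c - r1 rSources = Suc (c - Suc (r1 rSources))" using cc by simp
    then have \<Phi>1: "(c - r1 rSources) * source_cost c H =
        source_cost c H + (c - Suc (r1 rSources)) * source_cost c H"
      by (simp only: mult_Suc)
    show ?case
    proof (rule ht_Seq[where ?N2.0 = 0 and ?N1.0 = "if r1 rU \<in> H then source_cost c H else 0"],
        rule ht_Cond, goal_cases)
      case 1
      then have u: "r1 rU \<in> H" using del by simp
      show ?case
      proof (intro ht_Seq0 ht_set, rule ht_check_source[where H = H and c = c and s = "r1 rU"], goal_cases)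
        case (8 r2 a2)
        have ru: "r2 rU = r1 rU" "r2 rSources = Suc (r1 rSources)" using 8(1) by simp_all
        have "agree {rFound..rHit} r (r2(rU := Suc (r1 rU)))"
          using I(1) 8(1) by auto
        moreover have "agree {aCount..aQueue} a a2" using I(2) 8(2) by auto
        ultimately have "?I (r2(rU := Suc (r1 rU))) a2"
          using 8(3) ru I(3,4) cardC[of "r1 rU"] C[of "r1 rU"] u by auto
        then show ?case using \<Phi>1 ru u lt by (intro ht_set) simp
      qed (use reg f0 u in simp_all)
    next
      case 2
      then have u: "r1 rU \<notin> H" using del by simp
      then have "?I (r1(rU := Suc (r1 rU))) a1"
        using I f0 cardC[of "r1 rU"] C[of "r1 rU"] by simp
      then show ?case using u lt by (intro ht_Skip ht_set) simp
    qed simp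
  next
    case (4 r1 a1)
    then have I: "?I r1 a1" by simp
    have "robustly_connected c E H" if f0: "r1 rFound = 0"
    proof (rule robustly_connectedI[OF fin])
      show "?C (r1 rU) \<subseteq> H" by auto
      have "n \<le> r1 rU \<or> c \<le> r1 rSources" using 4 I f0 r by auto
      then show "?C (r1 rU) = H \<or> c \<le> card (?C (r1 rU))" using I Hn by auto
    next
      fix s v U
      assume "s \<in> ?C (r1 rU)" "v \<in> H" "s \<noteq> v" "U \<subseteq> H" "card U < c" "s \<notin> U" "v \<notin> U"
      moreover have "\<forall>s\<in>?C (r1 rU). \<forall>v\<in>H. v \<noteq> s \<longrightarrow> inseparable c H s v" using I f0 by simp
      ultimately have "inseparable c H s v" by metis
      then show "(s, v) \<in> (linked E (H - U))\<^sup>*"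
        using \<open>U \<subseteq> H\<close> \<open>card U < c\<close> \<open>s \<notin> U\<close> \<open>v \<notin> U\<close> by (simp add: inseparable_def)
    qed
    then show ?case using I by (intro Q) auto
  qed
qed

lemma le_pos: "n \<le> pos n * pos m" "m \<le> pos n * pos m" "n * m \<le> pos n * pos m"
proof -
  have "n \<le> pos n" "m \<le> pos m" "1 \<le> pos n" "1 \<le> pos m" by (auto simp: pos_def)
  then show "n * m \<le> pos n * pos m" "n \<le> pos n * pos m" "m \<le> pos n * pos m"
    using mult_le_mono[of n "pos n" m "pos m"] mult_le_mono[of n "pos n" 1 "pos m"]
      mult_le_mono[of 1 "pos n" m "pos m"] by simp_all
qed

text \<open>Two bounds on \<open>card H\<close> are used side by side: \<open>n * card H\<close> is
  estimated by \<open>card H \<le> 2 * m + 1\<close>, and \<open>m * card H\<close> by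
  \<open>card H \<le> n\<close>. So both products stay within a multiple of \<open>n * m\<close> and
  \<open>n\<close>.\<close>

lemma pairs_cost_le:
  assumes "H \<subseteq> {..<n}"
  shows "pairs_cost H \<le> 13 * (pos n * pos m)"
proof -
  have card: "card H \<le> n" using card_mono[OF _ assms] by simp
  note p = le_pos
  show ?thesis
  proof (cases "card H \<le> 2 * m + 1")
    case True
    have "n * card H \<le> n * (2 * m + 1)" using True by (intro mult_le_mono) auto
    moreover have "m * card H \<le> m * n" using card by simp
    moreover have "pairs_cost H = n + 2 * (n * card H) + 4 * (m * card H)"
      using True by (simp add: pairs_cost_def algebra_simps)
    ultimately have "pairs_cost H \<le> n + 2 * (n * (2 * m + 1)) + 4 * (m * n)" by linarith
    also have "\<dots> = 3 * n + 8 * (n * m)" by (simp add: algebra_simps)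
    finally show ?thesis using p by simp
  next
    case False
    then show ?thesis using p by (simp add: pairs_cost_def)
  qed
qed

text \<open>One factor \<open>c\<close> counts the sources, the other the searches for each pair.
  For \<open>c = 0\<close> there is no source at all, so that no bound on \<open>card H\<close> is
  required.\<close>

lemma flows_cost_le:
  assumes "H \<subseteq> {..<n}" "card H \<le> 2 * m + 1 \<or> c = 0"
  shows "flows_cost c H \<le> 20 * ((pos c)\<^sup>2 * pos n * pos m)"
proof (cases "c = 0")
  case True
  then have "flows_cost c H = n" "(pos c)\<^sup>2 * pos n * pos m = pos n * pos m"
    using True by (simp_all add: flows_cost_def pos_def[of 0])
  then show ?thesis using le_pos(1) by linarith
next
  case False
  let ?q = "pos n * pos m"
  have card: "card H \<le> n" using card_mono[OF _ assms(1)] by simp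
  note p = le_pos
  have c: "c \<le> c\<^sup>2" "1 \<le> c" using False by (auto simp: power2_eq_square)
  have hn: "card H * n \<le> 3 * ?q"
  proof -
    have "card H * n \<le> (2 * m + 1) * n" using assms(2) False by (intro mult_le_mono) auto
    also have "\<dots> = 2 * (n * m) + n" by (simp add: algebra_simps)
    finally show ?thesis using p by simp
  qed
  have hm: "card H * m \<le> ?q" using card p(3) by (meson le_trans mult_le_mono1)
  have "card H * (3 * n + 2 * m + 1) \<le> 3 * (card H * n) + 2 * (card H * m) + n"
    using card by (simp add: algebra_simps)
  then have "card H * (3 * n + 2 * m + 1) \<le> 12 * ?q" using hn hm p by linarith
  then have "c * (card H * (3 * n + 2 * m + 1)) \<le> c * (12 * ?q)" by (rule mult_le_mono2)
  moreover have "source_cost c H = n + card H * n + c * (card H * (3 * n + 2 * m + 1))"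
    unfolding source_cost_def by (simp only: distrib_left mult_ac add_ac)
  ultimately have "source_cost c H \<le> 4 * ?q + c * (12 * ?q)" using hn p by linarith
  also have "\<dots> \<le> c * (4 * ?q) + c * (12 * ?q)" using c(2) by simp
  finally have "source_cost c H \<le> c * (16 * ?q)" by (simp add: algebra_simps)
  then have "c * source_cost c H \<le> c\<^sup>2 * (16 * ?q)"
    using mult_le_mono2[of _ _ c] by (simp add: power2_eq_square mult.assoc)
  moreover have "n \<le> c\<^sup>2 * ?q" using p(1) c by (metis le_trans mult_le_mono mult_1)
  ultimately have "flows_cost c H \<le> 17 * (c\<^sup>2 * ?q)" by (simp add: flows_cost_def)
  then show ?thesis using False by (simp add: pos_def mult_ac)
qed

text \<open>The constant is \<open>13 + 20\<close>. Positive \<open>c\<close> comes with positive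
  \<open>\<tau>\<close>, so whenever searches are run, the successful pair check has already bounded
  \<open>card H\<close> by \<open>2 * m + 1\<close>.\<close>

lemma ht_check:
  assumes r: "r rN = n" "r rAlpha = \<alpha>" "r rTau = \<tau>" "r rConn = c" "alive a = H"
    and \<tau>: "0 < c \<Longrightarrow> 0 < \<tau>" and N: "33 * ((pos c)\<^sup>2 * pos n * pos m) \<le> N"
    and Q: "\<And>r' a'. agree {rFound..rHit} r r' \<Longrightarrow> agree {aCount..aQueue} a a' \<Longrightarrow>
      r' rFound = 0 \<and> good \<alpha> \<tau> c E H \<or>
      r' rFound = 1 \<and> r' rFst \<in> H \<and> r' rSnd \<in> H \<and> r' rFst \<noteq> r' rSnd \<and>
        (\<forall>S\<subseteq>H. good \<alpha> \<tau> c E S \<longrightarrow> \<not> (r' rFst \<in> S \<and> r' rSnd \<in> S)) \<Longrightarrow> Q r' a'"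
  shows "ht check r a N Q"
proof -
  have fin: "finite H" and Hn: "H \<subseteq> {..<n}" using r by auto
  define X where "X = (pos c)\<^sup>2 * pos n * pos m"
  have "1 \<le> (pos c)\<^sup>2" by (simp add: pos_def)
  then have "pos n * pos m \<le> X"
    using mult_le_mono1[of 1 "(pos c)\<^sup>2" "pos n * pos m"] by (simp add: mult.assoc X_def)
  then have pc: "pairs_cost H \<le> 13 * X" using pairs_cost_le[OF Hn] by linarith
  have bad: "\<not> (u \<in> S \<and> v \<in> S)"
    if "\<not> pair_ok \<alpha> \<tau> E H u v" "u \<noteq> v" "S \<subseteq> H" "good \<alpha> \<tau> c E S" for S u v
    using that pair_ok_mono[OF _ _ fin] unfolding good_def by metis
  show ?thesis
    unfolding check_def
  proof (rule ht_Seq0, rule ht_set, rule ht_Seq[where ?N1.0 = "13 * X" and ?N2.0 = "20 * X"],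
      rule ht_check_pairs[where H = H and \<alpha> = \<alpha> and \<tau> = \<tau>], goal_cases)
    case (7 r1 a1)
    have "card H \<le> 2 * m + 1 \<or> c = 0"
    proof (cases "H = {}")
      case False
      then obtain u where u: "u \<in> H" by blast
      then show ?thesis using card_alive_le[OF Hn u, of \<tau> \<alpha>] 7(4) \<tau> by auto
    qed simp
    note fc = flows_cost_le[OF Hn this, folded X_def]
    have reg: "r1 rN = n" "r1 rConn = c" "alive a1 = H" using 7(1,2) r by simp_all
    show ?case
    proof (rule ht_check_flows[where r = r1 and a = a1, OF reg(1,2) 7(3) reg(3) fc], rule Q, goal_cases)
      case (1 r2 a2)
      then show ?case using 7(1) by auto
    next
      case (2 r2 a2)
      then show ?case using 7(2) by auto
    next
      case (3 r2 a2)
      then show ?case using 7(4) separated_imp[of c H "r2 rFst" "r2 rSnd"]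
        by (auto simp: good_def separated_def)
    qed
  next
    case (8 r1 a1)
    \<comment> \<open>A bad pair has been found already: the loop is not entered and the pair is
      left untouched.\<close>
    have "ht check_flows r1 a1 n (\<lambda>r' a'. agree {rU, rSources} r1 r' \<and> a' = a1)"
      unfolding check_flows_def
      by (intro ht_Seq0 ht_set, rule ht_While[where M = "\<lambda>_ _. 0" and \<Phi> = "\<lambda>_ _. 0"
        and I = "\<lambda>r' a'. agree {rU, rSources} r1 r' \<and> a' = a1"]) (use 8(3) in simp_all)
    then show ?case
    proof (rule ht_mono)
      fix r2 a2 assume 2: "agree {rU, rSources} r1 r2 \<and> a2 = a1"
      have "agree {rFound..rHit} r r2" using 2 8(1) by auto
      moreover have "r2 rFound = 1" "r2 rFst = r1 rFst" "r2 rSnd = r1 rSnd"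
        using 2 8(3) by simp_all
      ultimately show "Q r2 a2" using 2 8 bad[OF 8(7,6)] by (intro Q) auto
    next
      have "n \<le> X" using le_pos(1) \<open>pos n * pos m \<le> X\<close> by linarith
      then show "n \<le> 20 * X" by simp
    qed
  qed (use r pc N[folded X_def] in auto)
qed

end

section \<open>The search tree\<close>

abbreviation "below_top \<equiv> Sub (V rDepth) (Const 1)"

definition branch :: com where
  "branch = put aFst (V rDepth) (V rFst) ;; put aSnd (V rDepth) (V rSnd) ;;
     put aPhase (V rDepth) (Const 0) ;; put aDel (V rFst) (Const 1) ;; incr rDepth"

text \<open>Drops the frames with both deletions tried. Only the second vertex is restored, the
  first having been restored when the frame was switched.\<close>

definition undo :: com where
  "undo = While (Conj (Less (Const 0) (V rDepth)) (Equal (A aPhase below_top) (Const 1)))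
     (rDepth :=: below_top ;; put aDel (A aSnd (V rDepth)) (Const 0))"

definition backtrack :: com where
  "backtrack = undo ;;
     Cond (eqc rDepth 0) (rRunning :=: Const 0)
       (put aDel (A aFst below_top) (Const 0) ;; put aDel (A aSnd below_top) (Const 1) ;;
        put aPhase below_top (Const 1))"

definition explore :: com where
  "explore = While (eqc rRunning 1)
     (check ;;
      Cond (eqc rFound 0) (rResult :=: Const 1 ;; rRunning :=: Const 0)
        (Cond (Less (V rDepth) (V rBudget)) branch backtrack))"

text \<open>
  A frame \<open>(u, v, b)\<close> of the stack stands for a bad pair \<open>u\<close>, \<open>v\<close>; first \<open>u\<close> is deleted, and
  later, when \<open>b\<close> is set, \<open>v\<close>. Top of the stack first.
\<close>

type_synonym frames = "(nat \<times> nat \<times> bool) list"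

fun live :: "nat \<Rightarrow> frames \<Rightarrow> nat set" where
  "live n [] = {..<n}"
| "live n ((u, v, b) # st) = live n st - {if b then v else u}"

fun valid :: "nat \<Rightarrow> (nat set \<Rightarrow> bool) \<Rightarrow> frames \<Rightarrow> bool" where
  "valid n sol [] \<longleftrightarrow> True"
| "valid n sol ((u, v, b) # st) \<longleftrightarrow> valid n sol st \<and> u \<in> live n st \<and> v \<in> live n st \<and> u \<noteq> v \<and>
     (\<forall>S\<subseteq>live n st. sol S \<longrightarrow> \<not> (u \<in> S \<and> v \<in> S))"

text \<open>A solution that is not inside the current live set must survive in a second branch that
  has not been entered yet.\<close>

fun pending :: "nat \<Rightarrow> (nat set \<Rightarrow> bool) \<Rightarrow> frames \<Rightarrow> bool" where
  "pending n sol [] \<longleftrightarrow> False"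
| "pending n sol ((u, v, b) # st) \<longleftrightarrow>
     (\<not> b \<and> (\<exists>S\<subseteq>live n st - {v}. sol S)) \<or> pending n sol st"

text \<open>The head of the list is the top of the stack, so a frame sits at the index given by the
  number of frames below it.\<close>

fun stored :: "arrays \<Rightarrow> frames \<Rightarrow> bool" where
  "stored a [] \<longleftrightarrow> True"
| "stored a ((u, v, b) # st) \<longleftrightarrow> a aFst (length st) = u \<and> a aSnd (length st) = v \<and>
     a aPhase (length st) = of_bool b \<and> stored a st"

lemma stored_cong:
  assumes "stored a st"
    "\<And>i. i < length st \<Longrightarrow> a' aFst i = a aFst i \<and> a' aSnd i = a aSnd i \<and> a' aPhase i = a aPhase i"
  shows "stored a' st"
  using assms
proof (induction st)
  case (Cons x st)
  obtain u v b where x: "x = (u, v, b)" by (cases x)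
  have "stored a' st" using Cons x by simp
  then show ?case using Cons(2) Cons(3)[of "length st"] x by simp
qed simp

lemma live_subset: "live n st \<subseteq> {..<n}"
  by (induction n st rule: live.induct) auto

lemma card_live: "valid n sol st \<Longrightarrow> card (live n st) = n - length st"
proof (induction n sol st rule: valid.induct)
  case (2 n sol u v b st)
  have "finite (live n st)" using live_subset finite_subset by blast
  then show ?case using 2 by (auto simp: card_Diff_singleton_if)
qed simp

text \<open>Sizes of the search tree below a node at depth \<open>d\<close>, and below the pending nodes.\<close>

definition nodes :: "nat \<Rightarrow> nat \<Rightarrow> nat" where "nodes l d = 2 ^ (Suc l - d) - 1"

definition pending_nodes :: "nat \<Rightarrow> (nat \<Rightarrow> nat) \<Rightarrow> nat \<Rightarrow> nat" where
  "pending_nodes l ph d = (\<Sum>i<d. if ph i = 0 then nodes l (Suc i) else 0)"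

lemma nodes_rec: "d < l \<Longrightarrow> nodes l d = 1 + 2 * nodes l (Suc d)"
proof -
  assume "d < l"
  then obtain j where "l = d + Suc j" using less_iff_Suc_add by auto
  then have "nodes l d = 2 * 2 ^ Suc j - 1" "nodes l (Suc d) = 2 ^ Suc j - 1"
    by (simp_all add: nodes_def)
  moreover have "(1::nat) \<le> 2 ^ Suc j" by simp
  ultimately show ?thesis by linarith
qed

lemma nodes_leaf: "nodes l l = 1"
  by (simp add: nodes_def Suc_diff_le)

lemma pending_nodes_Suc:
  "pending_nodes l ph (Suc d) = pending_nodes l ph d + (if ph d = 0 then nodes l (Suc d) else 0)"
  by (simp add: pending_nodes_def)

lemma pending_nodes_cong:
  "(\<And>i. i < d \<Longrightarrow> ph' i = ph i) \<Longrightarrow> pending_nodes l ph' d = pending_nodes l ph d"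
  unfolding pending_nodes_def by (intro sum.cong) auto

context graph_input
begin

text \<open>A frame in its second phase contributes neither to \<open>pending\<close> nor to
  \<open>pending_nodes\<close>, so popping it changes neither.\<close>

lemma ht_undo:
  assumes st: "stored a st" "valid n sol st" "alive a = live n st" "r rDepth = length st"
    and N: "length st \<le> N"
    and Q: "\<And>r' a' st'. agree {rDepth} r r' \<Longrightarrow> agree {aDel} a a' \<Longrightarrow> stored a' st' \<Longrightarrow>
      valid n sol st' \<Longrightarrow> alive a' = live n st' \<Longrightarrow> r' rDepth = length st' \<Longrightarrow> length st' \<le> length st \<Longrightarrow>
      pending n sol st' = pending n sol st \<Longrightarrow>
      pending_nodes l (a' aPhase) (length st') = pending_nodes l (a aPhase) (length st) \<Longrightarrow>
      (\<And>u v b st''. st' = (u, v, b) # st'' \<Longrightarrow> \<not> b) \<Longrightarrow> Q r' a'"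
  shows "ht undo r a N Q"
  unfolding undo_def
proof (rule ht_While[where M = "\<lambda>_ _. 0" and \<Phi> = "\<lambda>r a. r rDepth"
      and I = "\<lambda>r' a'. agree {rDepth} r r' \<and> agree {aDel} a a' \<and> (\<exists>st'. stored a' st' \<and>
         valid n sol st' \<and> alive a' = live n st' \<and> r' rDepth = length st' \<and> length st' \<le> length st \<and>
         pending n sol st' = pending n sol st \<and>
         pending_nodes l (a' aPhase) (length st') = pending_nodes l (a aPhase) (length st))"],
    goal_cases)
  case 1
  then show ?case using st by blast
next
  case 2
  then show ?case using st N by simp
next
  case (3 r1 a1)
  then obtain st1 where I: "agree {rDepth} r r1" "agree {aDel} a a1" "stored a1 st1"
    "valid n sol st1" "alive a1 = live n st1" "r1 rDepth = length st1" "length st1 \<le> length st"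
    "pending n sol st1 = pending n sol st"
    "pending_nodes l (a1 aPhase) (length st1) = pending_nodes l (a aPhase) (length st)" by blast
  from 3(2) I(6) obtain u v b st2 where st1: "st1 = (u, v, b) # st2" by (cases st1) auto
  have b: "b" using 3(2) I(3,6) st1 by (cases b) auto
  let ?a = "a1(aDel := (a1 aDel)(v := 0))" and ?r = "r1(rDepth := length st2)"
  have v: "v \<in> live n st2" "v < n" using I(4) st1 live_subset[of n st2] by auto
  have "agree {rDepth} r ?r" "agree {aDel} a ?a" using I(1,2) by auto
  moreover have "stored ?a st2"
    using I(3) st1 by (auto intro: stored_cong)
  moreover have "alive ?a = insert v (alive a1)" using v by auto
  then have "alive ?a = live n st2" using I(5) st1 b v by auto
  moreover have "pending_nodes l (?a aPhase) (length st2) = pending_nodes l (a aPhase) (length st)"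
    using I(3,9) b st1 by (simp add: pending_nodes_Suc)
  ultimately have I1: "agree {rDepth} r ?r \<and> agree {aDel} a ?a \<and> (\<exists>st'. stored ?a st' \<and>
         valid n sol st' \<and> alive ?a = live n st' \<and> ?r rDepth = length st' \<and> length st' \<le> length st \<and>
         pending n sol st' = pending n sol st \<and>
         pending_nodes l (?a aPhase) (length st') = pending_nodes l (a aPhase) (length st))"
    using I st1 b by (intro conjI exI[of _ st2]) simp_all
  have d: "a1 aSnd (length st2) = v" "r1 rDepth = Suc (length st2)" using I(3,6) st1 by auto
  then have "ht (rDepth :=: below_top ;; put aDel (A aSnd (V rDepth)) (Const 0)) r1 a1 0
      (\<lambda>r' a'. r' = ?r \<and> a' = ?a)"
    by (intro ht_intros) simp_all
  moreover have "0 + 1 + ?r rDepth \<le> r1 rDepth" using d by simp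
  ultimately show ?case by - (rule ht_result, assumption, simp, rule conjI[OF I1])
next
  case (4 r1 a1)
  then obtain st1 where I: "agree {rDepth} r r1" "agree {aDel} a a1" "stored a1 st1"
    "valid n sol st1" "alive a1 = live n st1" "r1 rDepth = length st1" "length st1 \<le> length st"
    "pending n sol st1 = pending n sol st"
    "pending_nodes l (a1 aPhase) (length st1) = pending_nodes l (a aPhase) (length st)" by blast
  show ?case
  proof (rule Q[OF I])
    fix u v b st2 assume "st1 = (u, v, b) # st2"
    then show "\<not> b" using 4(2) I(3,6) by auto
  qed
qed

text \<open>The price of a node: one check, at most \<open>l\<close> pops, and 1 for the round
  itself.\<close>

definition search_cost :: "nat \<Rightarrow> nat \<Rightarrow> nat" where
  "search_cost c l = 33 * ((pos c)\<^sup>2 * pos n * pos m) + l + 1"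

lemma ht_explore:
  assumes r: "r rN = n" "r rAlpha = \<alpha>" "r rTau = \<tau>" "r rConn = c" "r rDepth = 0" "r rResult = 0"
      "r rBudget = n - k" "r rRunning = 1" "\<And>i. a aDel i = 0"
    and k: "k \<le> n" and \<tau>: "0 < c \<Longrightarrow> 0 < \<tau>"
    and N: "search_cost c (n - k) * nodes (n - k) 0 \<le> N"
    and Q: "\<And>r' a'. r' rResult = of_bool (\<exists>S\<subseteq>{..<n}. good \<alpha> \<tau> c E S \<and> k \<le> card S) \<Longrightarrow> Q r' a'"
  shows "ht explore r a N Q"
proof -
  define sol where "sol S \<longleftrightarrow> good \<alpha> \<tau> c E S \<and> k \<le> card S" for S
  define l where "l = n - k"
  define solvable where "solvable \<longleftrightarrow> (\<exists>S\<subseteq>{..<n}. sol S)"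
  define C where "C = 33 * ((pos c)\<^sup>2 * pos n * pos m)"
  let ?fixed = "\<lambda>r'. r' rN = n \<and> r' rAlpha = \<alpha> \<and> r' rTau = \<tau> \<and> r' rConn = c \<and> r' rBudget = l"
  let ?stack = "\<lambda>r' a' st. stored a' st \<and> valid n sol st \<and> alive a' = live n st \<and>
    r' rDepth = length st \<and> length st \<le> l"
  let ?I = "\<lambda>r' a'. ?fixed r' \<and>
    (r' rRunning = 1 \<and> r' rResult = 0 \<and>
       (\<exists>st. ?stack r' a' st \<and> (solvable \<longrightarrow> (\<exists>S\<subseteq>live n st. sol S) \<or> pending n sol st)) \<or>
     r' rRunning = 0 \<and> r' rResult = of_bool solvable)"
  \<comment> \<open>Every round processes one node, and the potential prices all nodes not yet
    processed: the subtree at the current node and those of the second branches on the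
    stack.\<close>
  let ?\<Phi> = "\<lambda>r a. if r rRunning = (1::nat)
     then (C + l + 1) * (nodes l (r rDepth) + pending_nodes l (a aPhase) (r rDepth)) else 0"
  show ?thesis
    unfolding explore_def
  proof (rule ht_While[where M = "\<lambda>_ _. C + l" and \<Phi> = ?\<Phi> and I = ?I], goal_cases)
    case 1
    have "alive a = live n []" using r by auto
    then have "?stack r a []" using r by simp
    moreover have "solvable \<longrightarrow> (\<exists>S\<subseteq>live n []. sol S)" by (simp add: solvable_def)
    ultimately show ?case using r l_def by blast
  next
    case 2
    then show ?case using N r by (simp add: search_cost_def C_def l_def pending_nodes_def)
  next
    case (3 r1 a1)
    then obtain st where fx: "?fixed r1" and st: "?stack r1 a1 st"
      and ex: "solvable \<longrightarrow> (\<exists>S\<subseteq>live n st. sol S) \<or> pending n sol st"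
      and run: "r1 rRunning = 1" "r1 rResult = 0" by auto
    let ?H = "live n st"
    have card: "card ?H = n - length st" using card_live st by blast
    have fin: "finite ?H" using live_subset finite_subset by blast
    show ?case
    proof (rule ht_Seq[where ?N1.0 = C and ?N2.0 = l],
        rule ht_check[where H = ?H and \<alpha> = \<alpha> and \<tau> = \<tau> and c = c], goal_cases)
      case (8 r2 a2)
      have reg: "r2 x = r1 x" if "x \<notin> {rFound..rHit}" for x using 8(1) that by blast
      have arr: "a2 x = a1 x" if "x \<notin> {aCount..aQueue}" for x using 8(2) that by blast
      have fx2: "?fixed r2" using fx reg by simp
      have run2: "r2 rRunning = 1" "r2 rResult = 0" using run reg by simp_all
      have "stored a2 st" using st arr by (auto intro: stored_cong)
      then have st2: "?stack r2 a2 st" using st reg[of rDepth] arr[of aDel] by simp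
      have \<Phi>2: "?\<Phi> r1 a1 = (C + l + 1) * (nodes l (length st) + pending_nodes l (a2 aPhase) (length st))"
        using run st arr[of aPhase] by simp
      show ?case
      proof (rule ht_Cond, goal_cases)
        case 1
        then have "good \<alpha> \<tau> c E ?H" using 8(3) by auto
        \<comment> \<open>At most \<open>n - k\<close> vertices have been deleted, so a good live
          set is always large enough.\<close>
        moreover have "k \<le> n - length st" using st k unfolding l_def by linarith
        ultimately have "sol ?H" using card by (simp add: sol_def)
        then have "solvable" using live_subset solvable_def by blast
        moreover have "1 \<le> nodes l (length st)" using nodes_rec[of "length st" l] nodes_leaf[of l] st
          by (cases "length st = l") auto
        then have "(C + l + 1) * 1 \<le> ?\<Phi> r1 a1" unfolding \<Phi>2 by (intro mult_le_mono) auto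
        ultimately show ?case using fx2 by (intro ht_intros) auto
      next
        case 2
        let ?u = "r2 rFst" and ?v = "r2 rSnd"
        have uv: "?u \<in> ?H" "?v \<in> ?H" "?u \<noteq> ?v" "\<forall>S\<subseteq>?H. sol S \<longrightarrow> \<not> (?u \<in> S \<and> ?v \<in> S)"
          using 2 8(3) by (auto simp: sol_def)
        show ?case
        proof (rule ht_Cond, goal_cases)
          case 1
          then have lt: "length st < l" using fx2 st2 by simp
          let ?st = "(?u, ?v, False) # st"
          let ?r = "r2(rDepth := Suc (length st))"
          let ?a = "a2(aFst := (a2 aFst)(length st := ?u), aSnd := (a2 aSnd)(length st := ?v),
            aPhase := (a2 aPhase)(length st := 0), aDel := (a2 aDel)(?u := 1))"
          have "stored ?a st" using \<open>stored a2 st\<close> by (rule stored_cong) auto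
          moreover have "alive ?a = alive a2 - {?u}" by auto
          ultimately have "?stack ?r ?a ?st" using st2 uv lt by simp
          moreover have "(\<exists>S\<subseteq>live n ?st. sol S) \<or> pending n sol ?st" if solvable
          proof -
            from ex that consider S where "S \<subseteq> ?H" "sol S" | "pending n sol st" by blast
            then show ?thesis
            proof cases
              case 1
              then have "S \<subseteq> ?H - {?u} \<or> S \<subseteq> ?H - {?v}" using uv(4) by blast
              then show ?thesis using 1(2) by auto
            qed simp
          qed
          moreover have "?fixed ?r" "?r rRunning = 1" "?r rResult = 0" using fx2 run2 by simp_all
          ultimately have I: "?I ?r ?a" by blast
          \<comment> \<open>Of the two subtrees below the node, one becomes the current one and the
            other is pending; the node itself pays for the round.\<close>
          have "?\<Phi> ?r ?a = (C + l + 1) *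
              (2 * nodes l (Suc (length st)) + pending_nodes l (a2 aPhase) (length st))"
            using run2 pending_nodes_cong[of "length st" "?a aPhase" "a2 aPhase" l]
            by (simp add: pending_nodes_Suc)
          then have le: "C + l + 1 + ?\<Phi> ?r ?a \<le> ?\<Phi> r1 a1"
            unfolding \<Phi>2 nodes_rec[OF lt] by (simp add: algebra_simps)
          have "ht branch r2 a2 l (\<lambda>r' a'. r' = ?r \<and> a' = ?a)"
            unfolding branch_def using st2 by (intro ht_intros) simp_all
          then show ?case by - (rule ht_result, assumption, simp, rule conjI[OF I le])
        next
          case 2
          then have len: "length st = l" using fx2 st2 by simp
          \<comment> \<open>With the budget used up, \<open>?H\<close> has exactly \<open>k\<close>
            vertices and is itself the only candidate, but it contains the bad pair.\<close>
          have "\<not> (\<exists>S\<subseteq>?H. sol S)"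
          proof
            assume "\<exists>S\<subseteq>?H. sol S"
            then obtain S where S: "S \<subseteq> ?H" "sol S" by blast
            then have "card ?H \<le> card S" using card len k by (simp add: sol_def l_def)
            then have "S = ?H" using S(1) fin card_seteq by blast
            then show False using uv S by blast
          qed
          then have pend: "solvable \<Longrightarrow> pending n sol st" using ex by blast
          have \<Phi>3: "?\<Phi> r1 a1 = (C + l + 1) * (1 + pending_nodes l (a2 aPhase) (length st))"
            unfolding \<Phi>2 len nodes_leaf ..
          show ?case unfolding backtrack_def
          proof (rule ht_Seq[where ?N1.0 = l and ?N2.0 = 0],
              rule ht_undo[where st = st and sol = sol and l = l], goal_cases)
            case (6 r3 a3 st3)
            have fx3: "?fixed r3" "r3 rRunning = 1" "r3 rResult = 0" using 6(1) fx2 run2 by simp_all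
            show ?case
            proof (rule ht_Cond, goal_cases)
              case 1
              then have "st3 = []" using 6(6) by simp
              then have "\<not> solvable" using 6(8) pend by auto
              then show ?case using fx3 \<Phi>3 by (intro ht_intros) simp
            next
              case 2
              then obtain u v b st4 where "st3 = (u, v, b) # st4" using 6(6) by (cases st3) auto
              then have st3: "st3 = (u, v, False) # st4" using 6(10) by auto
              have d: "r3 rDepth = Suc (length st4)" "a3 aFst (length st4) = u"
                "a3 aSnd (length st4) = v" "a3 aPhase (length st4) = 0" using 6(3,6) st3 by auto
              have val: "u \<in> live n st4" "v \<in> live n st4" "u \<noteq> v" "u < n" "v < n"
                using 6(4) st3 live_subset[of n st4] by auto
              let ?a = "a3(aDel := (a3 aDel)(u := 0, v := 1), aPhase := (a3 aPhase)(length st4 := 1))"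
              let ?st = "(u, v, True) # st4"
              have "stored a3 st4" using 6(3) st3 by simp
              then have "stored ?a st4" by (rule stored_cong) auto
              moreover have "alive ?a = insert u (alive a3) - {v}" using val by auto
              then have "alive ?a = live n ?st" using 6(5) st3 val by auto
              ultimately have "?stack r3 ?a ?st"
                using 6(4,7) st3 d len by simp
              moreover have "(\<exists>S\<subseteq>live n ?st. sol S) \<or> pending n sol ?st" if solvable
                using pend[OF that] 6(8) st3 by auto
              ultimately have I: "?I r3 ?a" using fx3 by blast
              have "pending_nodes l (a2 aPhase) (length st) =
                  pending_nodes l (a3 aPhase) (length st4) + nodes l (Suc (length st4))"
                using 6(9) st3 d by (simp add: pending_nodes_Suc)
              moreover have "pending_nodes l (?a aPhase) (r3 rDepth) =
                  pending_nodes l (a3 aPhase) (length st4)"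
                using d pending_nodes_cong[of "length st4" "?a aPhase" "a3 aPhase" l]
                by (simp add: pending_nodes_Suc)
              \<comment> \<open>The subtree of the second branch turns from pending into current,
                and the leaf just left pays for the round.\<close>
              ultimately have le: "C + l + 1 + ?\<Phi> r3 ?a \<le> ?\<Phi> r1 a1"
                unfolding \<Phi>3 using fx3 d by (simp add: algebra_simps)
              have "ht (put aDel (A aFst below_top) (Const 0) ;;
                  put aDel (A aSnd below_top) (Const 1) ;; put aPhase below_top (Const 1)) r3 a3 0
                  (\<lambda>r' a'. r' = r3 \<and> a' = ?a)"
                using d by (intro ht_intros) (simp_all add: fun_upd_twist)
              then show ?case by - (rule ht_result, assumption, simp, rule conjI[OF I le])
            qed
          qed (use st2 len in simp_all)
        qed
      qed
    qed (use fx st \<tau> C_def in simp_all)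
  next
    case (4 r1 a1)
    then have "r1 rResult = of_bool solvable" by auto
    then show ?case by (intro Q) (simp add: solvable_def sol_def)
  qed
qed

end

section \<open>Reading the input\<close>

lemma concat_nth:
  assumes "u < length adj" "i < length (adj ! u)"
  shows "length (concat (take u adj)) + i < length (concat adj)"
    "concat adj ! (length (concat (take u adj)) + i) = adj ! u ! i"
proof -
  have split: "concat adj = concat (take u adj) @ adj ! u @ concat (drop (Suc u) adj)"
    using assms(1) by (metis concat.simps(2) concat_append id_take_nth_drop)
  show "length (concat (take u adj)) + i < length (concat adj)"
    unfolding split using assms(2) by simp
  show "concat adj ! (length (concat (take u adj)) + i) = adj ! u ! i"
    unfolding split using assms(2) by (simp add: nth_append)
qed

text \<open>Double counting of ordered adjacent pairs: at most two of them form the same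
  edge.\<close>

lemma sum_degrees_le:
  assumes "simple_graph G" "adjacency_lists G adj"
  shows "(\<Sum>u<length adj. length (adj ! u)) \<le> 2 * card (edges G)"
proof -
  let ?E = "edges G" and ?n = "length adj"
  let ?P = "Sigma {..<?n} (\<lambda>u. {v. {u, v} \<in> ?E})"
  have V: "verts G = {..<?n}" using assms(2) by (simp add: adjacency_lists_def)
  have "?E \<subseteq> Pow {..<?n}" using assms(1) V by (auto simp: simple_graph_def)
  then have finE: "finite ?E" using finite_subset by blast
  have vE: "v < ?n" if "{u, v} \<in> ?E" for u v
    using that assms(1) V by (auto simp: simple_graph_def)
  have nb: "{v. {u, v} \<in> ?E} \<subseteq> {..<?n}" for u using vE by auto
  have fin: "finite ?P" using nb finite_subset by (intro finite_SigmaI) blast+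
  have "(\<Sum>u<?n. length (adj ! u)) = (\<Sum>u<?n. card {v. {u, v} \<in> ?E})"
    using assms(2) by (intro sum.cong) (auto simp: adjacency_lists_def distinct_card[symmetric])
  also have "\<dots> = card ?P" using nb finite_subset by (subst card_SigmaI) blast+
  also have "?P = (\<Union>e\<in>?E. {p \<in> ?P. {fst p, snd p} = e})" by auto
  also have "card \<dots> \<le> (\<Sum>e\<in>?E. card {p \<in> ?P. {fst p, snd p} = e})"
    using finE by (rule card_UN_le)
  also have "\<dots> \<le> (\<Sum>e\<in>?E. 2)"
  proof (rule sum_mono)
    fix e assume "e \<in> ?E"
    then have "card e = 2" using assms(1) by (simp add: simple_graph_def)
    then obtain x y where "e = {x, y}" by (auto simp: card_2_iff)
    then have "p \<in> {(x, y), (y, x)}" if "{fst p, snd p} = e" for p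
      using that by (cases p) (simp add: doubleton_eq_iff)
    then have "{p \<in> ?P. {fst p, snd p} = e} \<subseteq> {(x, y), (y, x)}" by blast
    then have "card {p \<in> ?P. {fst p, snd p} = e} \<le> card {(x, y), (y, x)}"
      by (rule card_mono[rotated]) simp
    also have "\<dots> \<le> 2" using card_length[of "[(x, y), (y, x)]"] by (simp only: list.set list.size)
    finally show "card {p \<in> ?P. {fst p, snd p} = e} \<le> 2" .
  qed
  finally show ?thesis by simp
qed

text \<open>The last of the \<open>n + 1\<close> addresses points behind the adjacency lists, so the
  program can read off the length of its own input; this is where the arrays begin.\<close>

lemma graph_input_encode:
  fixes t k :: nat
  assumes G: "simple_graph G" and adj: "adjacency_lists G adj"
  defines "xs \<equiv> encode adj t k" and "inp \<equiv> \<lambda>i. if i < length (encode adj t k) then encode adj t k ! i else 0"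
  shows "graph_input (length xs) inp (length adj) (card (edges G)) (edges G)"
    and "length xs = inp (3 + inp 0)" "4 + length adj \<le> length xs" "inp 0 = length adj"
      "inp 1 = t" "inp 2 = k"
proof -
  let ?n = "length adj"
  let ?off = "\<lambda>u. ?n + 4 + length (concat (take u adj))"
  have V: "verts G = {..<?n}" using adj by (simp add: adjacency_lists_def)
  have len: "length xs = ?n + 4 + length (concat adj)"
    by (simp add: xs_def encode_def)
  have off: "inp (3 + u) = ?off u" if "u \<le> ?n" for u
    using that len unfolding inp_def xs_def encode_def
    by (simp add: nth_append nth_Cons' del: upt_Suc length_concat)
  have offS: "inp (4 + u) = ?off (Suc u)" if "u < ?n" for u
    using off[of "Suc u"] that by simp
  have body: "inp (?n + 4 + i) = concat adj ! i" if "i < length (concat adj)" for i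
    using that len unfolding inp_def xs_def encode_def
    by (simp add: nth_append nth_Cons' del: upt_Suc length_concat)
  have step: "?off (Suc u) = ?off u + length (adj ! u)" if "u < ?n" for u
    using that by (simp add: take_Suc_conv_app_nth del: length_concat)
  have nb: "inp (?off u + i) = adj ! u ! i" if "u < ?n" "i < length (adj ! u)" for u i
    using body concat_nth[OF that] by (simp add: add.assoc del: length_concat)
  have inj: "inj_on inp {inp (3 + u)..<inp (4 + u)}"
    and img: "inp ` {inp (3 + u)..<inp (4 + u)} = {v. {u, v} \<in> edges G}" if u: "u < ?n" for u
  proof -
    have r: "{inp (3 + u)..<inp (4 + u)} = (+) (?off u) ` {..<length (adj ! u)}"
      using off[of u] offS[OF u] step[OF u] u
      by (simp add: lessThan_atLeast0 add_ac del: length_concat)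
    have d: "distinct (adj ! u)" and s: "set (adj ! u) = {v. {u, v} \<in> edges G}"
      using adj u by (auto simp: adjacency_lists_def)
    show "inj_on inp {inp (3 + u)..<inp (4 + u)}"
    proof (rule inj_onI)
      fix x y assume x: "x \<in> {inp (3 + u)..<inp (4 + u)}"
        and y: "y \<in> {inp (3 + u)..<inp (4 + u)}" and eq: "inp x = inp y"
      obtain i j where "x = ?off u + i" "i < length (adj ! u)" "y = ?off u + j" "j < length (adj ! u)"
        using x y unfolding r by blast
      then show "x = y" using eq nb[OF u, of i] nb[OF u, of j] nth_eq_iff_index_eq[OF d] by metis
    qed
    have "inp ` {inp (3 + u)..<inp (4 + u)} = (\<lambda>i. inp (?off u + i)) ` {..<length (adj ! u)}"
      unfolding r image_image ..
    also have "\<dots> = (!) (adj ! u) ` {..<length (adj ! u)}"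
      using nb[OF u] by (intro image_cong) auto
    also have "\<dots> = set (adj ! u)" by (auto simp: set_conv_nth)
    finally show "inp ` {inp (3 + u)..<inp (4 + u)} = {v. {u, v} \<in> edges G}" using s by simp
  qed
  have mono: "length (concat (take u adj)) \<le> length (concat adj)" for u
    using append_take_drop_id[of u adj] concat_append[of "take u adj" "drop u adj"]
    by (metis le_add1 length_append)
  show "graph_input (length xs) inp ?n (card (edges G)) (edges G)"
  proof (unfold_locales, goal_cases)
    case 1
    show ?case using len by simp
  next
    case (2 u)
    have "?off (Suc u) \<le> length xs" using mono[of "Suc u"] len by simp
    then show ?case using off[of u] offS[OF 2] step[OF 2] 2 by simp
  next
    case (5 e)
    then show ?case using G V by (simp add: simple_graph_def)
  next
    case 6
    have "inp (4 + u) - inp (3 + u) = length (adj ! u)" if "u < ?n" for u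
      using off[of u] offS[OF that] step[OF that] that by simp
    then show ?case using sum_degrees_le[OF G adj] by simp
  qed (use inj img in auto)
  show "4 + ?n \<le> length xs" using len by simp
  show 0: "inp 0 = ?n" and "inp 1 = t" and "inp 2 = k"
    using len by (simp_all add: inp_def xs_def encode_def nth_append)
  show "length xs = inp (3 + inp 0)" unfolding 0 using off[of ?n] len by simp
qed

section \<open>The complete program and its instances for the three problems\<close>

definition prepare :: "aexp \<Rightarrow> aexp \<Rightarrow> aexp \<Rightarrow> com" where
  "prepare \<alpha> \<tau> c = rN :=: Mem (Const 0) ;; rSize :=: Mem (Const 2) ;;
     rAlpha :=: \<alpha> ;; rTau :=: \<tau> ;; rConn :=: c"

text \<open>The first assignment installs the base address of the arrays in machine register 0, and
  the last one overwrites it with the answer; both therefore lie outside the view given by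
  \<open>emb\<close>. The guard excludes sizes above \<open>n\<close>, for which the truncated
  difference would be a wrong budget.\<close>

definition solver :: "com \<Rightarrow> com" where
  "solver pre = Assign 0 (Mem (Add (Const 3) (Mem (Const 0)))) ;;
     (pre ;;
      guarded (Neg (Less (V rN) (V rSize)))
        (rBudget :=: Sub (V rN) (V rSize) ;; rRunning :=: Const 1 ;; explore)) ;;
     Assign 0 (V rResult)"

text \<open>The size threshold \<open>K t k\<close> may exceed \<open>k\<close>; this only shrinks
  the search tree, so the bound \<open>2 ^ (n - k)\<close> remains valid.\<close>

lemma solvable_in_time_good:
  assumes pre: "\<And>B inp. 4 \<le> B \<Longrightarrow> ram_view.ht B inp pre (\<lambda>_. 0) (\<lambda>_ _. 0) 0
      (\<lambda>r a. a = (\<lambda>_ _. 0) \<and> r rN = inp 0 \<and> r rAlpha = \<alpha> (inp 1) \<and> r rTau = \<tau> (inp 1) \<and>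
         r rConn = c (inp 1) \<and> r rSize = K (inp 1) (inp 2) \<and> r rDepth = 0 \<and> r rResult = 0)"
    and Q: "\<And>t k G S. simple_graph G \<Longrightarrow> S \<subseteq> verts G \<Longrightarrow>
      Q t G S \<and> k \<le> card S \<longleftrightarrow> good (\<alpha> t) (\<tau> t) (c t) (edges G) S \<and> K t k \<le> card S"
    and K: "\<And>t k. k \<le> K t k" and c: "\<And>t. 0 < c t \<Longrightarrow> 0 < \<tau> t"
  shows "solvable_in_time Q (\<lambda>n m t k. 2 ^ (n - k) * ((pos (c t))\<^sup>2 * pos n * pos m))"
  unfolding solvable_in_time_def
proof (rule exI[of _ "solver pre"], rule exI[of _ "csize (solver pre) * 100"], intro allI impI)
  fix G adj t k assume G: "simple_graph G \<and> adjacency_lists G adj"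
  define xs where "xs = encode adj t k"
  define n where "n = length adj"
  define inp where "inp = (\<lambda>i. if i < length (encode adj t k) then encode adj t k ! i else 0)"
  let ?m = "card (edges G)" and ?B = "length xs"
  have enc: "graph_input ?B inp n ?m (edges G)" "?B = inp (3 + inp 0)" "4 + n \<le> ?B" "inp 0 = n"
    "inp 1 = t" "inp 2 = k"
    unfolding inp_def xs_def n_def
    by (rule graph_input_encode[OF conjunct1[OF G] conjunct2[OF G]])+
  interpret graph_input ?B inp n ?m "edges G" by (rule enc(1))
  have V: "verts G = {..<n}" using G by (simp add: adjacency_lists_def n_def)
  let ?init = "initial_state xs"
  have init: "?init = ((\<lambda>_. 0), inp)" by (simp add: initial_state_def inp_def xs_def)
  have emb0: "((fst ?init)(0 := ?B), snd ?init) = emb (\<lambda>_. 0) (\<lambda>_ _. 0)"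
    unfolding init emb_def by (auto simp: fun_eq_iff inp_def xs_def split: nat.split)
  define ans where "ans \<longleftrightarrow> (\<exists>S\<subseteq>{..<n}. good (\<alpha> t) (\<tau> t) (c t) (edges G) S \<and> K t k \<le> card S)"
  define X where "X = (pos (c t))\<^sup>2 * pos n * pos ?m"
  let ?main = "pre ;; guarded (Neg (Less (V rN) (V rSize)))
    (rBudget :=: Sub (V rN) (V rSize) ;; rRunning :=: Const 1 ;; explore)"
  have X: "1 \<le> X" "n \<le> X"
  proof -
    have "1 \<le> (pos (c t))\<^sup>2" "1 \<le> pos n * pos ?m" by (simp_all add: pos_def)
    then have "pos n * pos ?m \<le> X" unfolding X_def
      using mult_le_mono1[of 1 "(pos (c t))\<^sup>2" "pos n * pos ?m"] by (simp add: mult.assoc)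
    then show "1 \<le> X" "n \<le> X" using le_pos(1) \<open>1 \<le> pos n * pos ?m\<close> by linarith+
  qed
  have "ht ?main (\<lambda>_. 0) (\<lambda>_ _. 0) (70 * (2 ^ (n - k) * X)) (\<lambda>r a. r rResult = of_bool ans)"
  proof (rule ht_Seq0, rule ht_mono[OF pre], goal_cases)
    case (2 r a)
    then have r: "a = (\<lambda>_ _. 0)" "r rN = n" "r rAlpha = \<alpha> t" "r rTau = \<tau> t" "r rConn = c t"
      "r rSize = K t k" "r rDepth = 0" "r rResult = 0" unfolding enc by simp_all
    show ?case
    proof (rule ht_Cond, goal_cases)
      case 1
      then have le: "K t k \<le> n" using r by simp
      let ?l = "n - K t k"
      \<comment> \<open>In \<open>search_cost\<close>, each of \<open>?l\<close> and 1 is at most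
        \<open>X\<close>, which raises 33 to 35; the factor 2 comes from counting inner nodes along
        with leaves.\<close>
      have "search_cost (c t) ?l * nodes ?l 0 \<le> (35 * X) * (2 * 2 ^ (n - k))"
      proof (rule mult_le_mono)
        show "search_cost (c t) ?l \<le> 35 * X" unfolding search_cost_def X_def[symmetric] using X by linarith
        have "(2::nat) ^ ?l \<le> 2 ^ (n - k)" using K[of k t] by (intro power_increasing) auto
        then show "nodes ?l 0 \<le> 2 * 2 ^ (n - k)" unfolding nodes_def diff_zero power_Suc by linarith
      qed
      then have cost: "search_cost (c t) ?l * nodes ?l 0 \<le> 70 * (2 ^ (n - k) * X)"
        by (simp add: mult_ac)
      show ?case
        by (intro ht_Seq0 ht_set, rule ht_explore[where k = "K t k" and \<alpha> = "\<alpha> t" and \<tau> = "\<tau> t" and c = "c t"])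
          (use r le c cost in \<open>simp_all add: ans_def\<close>)
    next
      case 2
      then have "n < K t k" using r by simp
      moreover have "card S \<le> n" if "S \<subseteq> {..<n}" for S using card_mono[OF _ that] by simp
      ultimately have "\<not> ans" using leD le_less_trans unfolding ans_def by blast
      then show ?case using r by (intro ht_Skip) simp
    qed
  qed (use enc in simp_all)
  then obtain T r a where run: "exec ?main (emb (\<lambda>_. 0) (\<lambda>_ _. 0)) T (emb r a)"
    "T \<le> csize ?main * (70 * (2 ^ (n - k) * X) + 1)" "r rResult = of_bool ans"
    unfolding ht_def by blast
  let ?a1 = "Mem (Add (Const 3) (Mem (Const 0)))"
  let ?s = "((fst (emb r a))(0 := aval (V rResult) (emb r a)), snd (emb r a))"
  have "exec (Assign 0 ?a1) ?init (1 + acost ?a1) (emb (\<lambda>_. 0) (\<lambda>_ _. 0))"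
    using exec.Assign[of 0 ?a1 ?init] enc(2) emb0 by (simp add: init)
  from exec.Seq[OF this exec.Seq[OF run(1) exec.Assign[of 0 "V rResult"]]]
  have ex: "exec (solver pre) ?init (1 + acost ?a1 + (T + (1 + acost (V rResult)))) ?s"
    by (simp add: solver_def)
  let ?Y = "2 ^ (n - k) * X"
  have Y: "1 \<le> ?Y" using X(1) by simp
  \<comment> \<open>Rounding 70 up to 100 absorbs the additive 1, since \<open>?Y\<close> is
    positive.\<close>
  have "csize ?main * (70 * ?Y + 1) \<le> csize ?main * (100 * ?Y)" using Y by (intro mult_le_mono2) linarith
  then have "T \<le> csize ?main * (100 * ?Y)" using run(2) by (rule le_trans[rotated])
  moreover have "x \<le> x * (100 * ?Y)" for x using Y by simp
  ultimately have "1 + acost ?a1 + (T + (1 + acost (V rResult))) \<le>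
      (1 + acost ?a1) * (100 * ?Y) + (csize ?main * (100 * ?Y) + (1 + acost (V rResult)) * (100 * ?Y))"
    by (intro add_le_mono)
  also have "\<dots> = csize (solver pre) * 100 * ?Y"
    unfolding solver_def csize.simps(2,4) by (simp only: distrib_right mult.assoc)
  finally have time: "1 + acost ?a1 + (T + (1 + acost (V rResult))) \<le> csize (solver pre) * 100 * ?Y" .
  have "ans \<longleftrightarrow> (\<exists>S\<subseteq>verts G. Q t G S \<and> k \<le> card S)"
    unfolding ans_def V[symmetric] using Q G by blast
  then have "fst ?s 0 = (if \<exists>S\<subseteq>verts G. Q t G S \<and> card S \<ge> k then 1 else 0)"
    using run(3) by simp
  moreover have cardV: "card (verts G) = n" using V by simp
  ultimately show "\<exists>T s. exec (solver pre) (initial_state (encode adj t k)) T s \<and>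
      T \<le> csize (solver pre) * 100 *
        (2 ^ (card (verts G) - k) * ((pos (c t))\<^sup>2 * pos (card (verts G)) * pos (card (edges G)))) \<and>
      fst s 0 = (if \<exists>S\<subseteq>verts G. Q t G S \<and> card S \<ge> k then 1 else 0)"
    using ex time unfolding cardV X_def[symmetric] xs_def[symmetric] by blast
qed

lemma hereditary_solvable:
  "solvable_in_time hereditary_two_club (\<lambda>n m t k. 2 ^ (n - k) * (pos n * pos m))"
proof -
  \<comment> \<open>With \<open>c = 0\<close> the flow check is switched off and its factor is
    \<open>pos 0 = 1\<close>; the constant function is applied to \<open>t\<close> so that the bound
    has the shape of the general lemma.\<close>
  have "solvable_in_time hereditary_two_club
      (\<lambda>n m t k. 2 ^ (n - k) * ((pos ((\<lambda>_. 0) t))\<^sup>2 * pos n * pos m))"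
  proof (rule solvable_in_time_good[where \<alpha> = Suc and \<tau> = Suc and K = "\<lambda>t k. k" and
        pre = "prepare (Add (Mem (Const 1)) (Const 1)) (Add (Mem (Const 1)) (Const 1)) (Const 0)"], goal_cases)
    case (1 B inp)
    interpret ram_view B inp .
    show ?case unfolding prepare_def using 1 by (intro ht_intros) simp_all
  qed (simp_all add: hereditary_good)
  then show ?thesis by (simp add: pos_def[of 0])
qed

lemma robust_solvable:
  "solvable_in_time robust_two_club (\<lambda>n m t k. 2 ^ (n - k) * (pos n * pos m))"
proof -
  have "solvable_in_time robust_two_club
      (\<lambda>n m t k. 2 ^ (n - k) * ((pos ((\<lambda>_. 0) t))\<^sup>2 * pos n * pos m))"
  proof (rule solvable_in_time_good[where \<alpha> = "\<lambda>_. 1" and \<tau> = "\<lambda>t. t" and K = "\<lambda>t k. k" and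
        pre = "prepare (Const 1) (Mem (Const 1)) (Const 0)"], goal_cases)
    case (1 B inp)
    interpret ram_view B inp .
    show ?case unfolding prepare_def using 1 by (intro ht_intros) simp_all
  qed (simp_all add: robust_good)
  then show ?thesis by (simp add: pos_def[of 0])
qed

lemma connected_solvable:
  "solvable_in_time connected_two_club (\<lambda>n m t k. 2 ^ (n - k) * ((pos t)\<^sup>2 * pos n * pos m))"
proof (rule solvable_in_time_good[where \<alpha> = "\<lambda>_. 1" and \<tau> = "\<lambda>_. 1" and c = "\<lambda>t. t" and
      K = "\<lambda>t k. max k (Suc t)" and
      pre = "prepare (Const 1) (Const 1) (Mem (Const 1)) ;;
        guarded (Less (V rSize) (Add (V rConn) (Const 1))) (rSize :=: Add (V rConn) (Const 1))"], goal_cases)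
  case (1 B inp)
  interpret ram_view B inp .
  show ?case unfolding prepare_def using 1 by (intro ht_intros) (simp_all add: max_def)
qed (auto simp: connected_good)

theorem theorem3:
  "solvable_in_time hereditary_two_club (\<lambda>n m t k. 2 ^ (n - k) * (pos n * pos m)) \<and>
   solvable_in_time robust_two_club (\<lambda>n m t k. 2 ^ (n - k) * (pos n * pos m)) \<and>
   solvable_in_time connected_two_club (\<lambda>n m t k. 2 ^ (n - k) * ((pos t)\<^sup>2 * pos n * pos m))"
  using hereditary_solvable robust_solvable connected_solvable by blast

end
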